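(* Let $n\ge1$ be an integer. The normal vector of any critical central hyperplane section of $\Delta_n$ has at most three distinct nonzero coordinates. That is: if the unit vector $\mathbf a=(a_1,\dots,a_{n+1})\in\mathbb R^{n+1}$ with $\sum_{j=1}^{n+1}a_j=0$ is a critical point of $V$ subject to the constraints $\sum_{j=1}^{n+1} a_j=0$ and $\sum_{j=1}^{n+1} a_j^2=1$, then the set $\{a_j : 1\le j\le n+1,\ a_j\ne0\}$ has at most three elements.
   Context: $\Delta_n$ is the standard regular simplex, i.e. the convex hull of the standard basis vectors $\mathbf e_1,\dots,\mathbf e_{n+1}$ of $\mathbb R^{n+1}$. For a unit vector $\mathbf a\in\mathbb R^{n+1}$ with coordinate sum zero, the simplex section function is $V(\mathbf a)=\mathrm{Vol}_{n-1}(\Delta_n\cap\mathbf a^\perp)$, the $(n-1)$-dimensional volume of the central section with normal vector $\mathbf a$. It is known that $V(\mathbf a)=\frac{\sqrt{n+1}}{(n-1)!}\,\sigma(\mathbf a)$, where $\sigma(\mathbf a)=\frac1{2\pi}\int_{-\infty}^\infty\prod_{j=1}^{n+1}\frac{1}{1+\mathrm i a_jt}\,dt$. A section $\Delta_n\cap\mathbf a^\perp$ is critical if its normal vector $\mathbf a$ is a constrained critical point of $V$, i.e. the function $V$ on the manifold $\{\mathbf a\in\mathbb R^{n+1}:\sum_j a_j=0,\ \sum_j a_j^2=1\}$ is differentiable at $\mathbf a$ and its differential vanishes there. *)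

theory Defs
  imports "HOL-Analysis.Analysis"
begin

(* An affine orthonormal coordinate system, with origin p and axes B, of a k-dimensional flat
   containing S. *)
definition orthonormal_frame ::
  "nat \<Rightarrow> 'a::euclidean_space set \<Rightarrow> 'a \<Rightarrow> 'a set \<Rightarrow> bool" where
  "orthonormal_frame k S p B \<longleftrightarrow>
     finite B \<and> card B = k \<and> pairwise orthogonal B \<and> (\<forall>b\<in>B. norm b = 1) \<and>
     S \<subseteq> (+) p ` span B"

(* The k-dimensional volume of a subset of a k-dimensional flat: the k-dimensional product Lebesgue
   measure of S in orthonormal coordinates (compare lborel_eq).  The value is independent
   of the chosen frame, by invariance of Lebesgue measure under isometries; if S lies in two
   different k-flats, it lies in a flat of lower dimension and the value is 0 for both.
   Indexing the coordinates by B rather than by a type admits k = 0, where the measure is the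
   counting measure on a point.  Unspecified if S lies in no k-flat. *)
definition flat_volume :: "nat \<Rightarrow> 'a::euclidean_space set \<Rightarrow> real" where
  "flat_volume k S =
     (case (SOME (p, B). orthonormal_frame k S p B) of
        (p, B) \<Rightarrow> measure (\<Pi>\<^sub>M b\<in>B. (lborel :: real measure))
          {x \<in> space (\<Pi>\<^sub>M b\<in>B. (lborel :: real measure)). p + (\<Sum>b\<in>B. x b *\<^sub>R b) \<in> S})"

(* In dimension n + 1 = CARD('m). *)
definition standard_simplex :: "(real ^ 'm) set" where
  "standard_simplex = convex hull (range (\<lambda>j. axis j 1))"

(* For CARD('m) = n + 1 the dimension CARD('m) - 2 is n - 1; no truncation occurs for n \<ge> 1. *)
definition section_volume :: "real ^ 'm \<Rightarrow> real" where
  "section_volume a = flat_volume (CARD('m) - 2) (standard_simplex \<inter> {x. a \<bullet> x = 0})"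

definition normal_manifold :: "(real ^ 'm) set" where
  "normal_manifold = {a. (\<Sum>j\<in>UNIV. a $ j) = 0 \<and> (\<Sum>j\<in>UNIV. (a $ j)\<^sup>2) = 1}"

definition normal_tangent_space :: "real ^ 'm \<Rightarrow> (real ^ 'm) set" where
  "normal_tangent_space a = {h. (\<Sum>j\<in>UNIV. h $ j) = 0 \<and> a \<bullet> h = 0}"

(* The derivative within the manifold only depends on the values of V there.  It determines D only on
   the tangent space; the restriction of D to that space is the differential at a. *)
definition critical_normal :: "real ^ 'm \<Rightarrow> bool" where
  "critical_normal a \<longleftrightarrow> a \<in> normal_manifold \<and>
     (\<exists>D. (section_volume has_derivative D) (at a within normal_manifold) \<and>
          (\<forall>h\<in>normal_tangent_space a. D h = 0))"

end

(*
Let p be the density of the sum of the a_j X_j for independent standard exponential X_j. The section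
volume is a constant times p(0). Write T_c for the operator f(x) |-> E f(x - c X), the inverse of
1 + c D. The partial derivative of p(0) in a_j <> 0 is (T_{a_j} p(0) - p(0)) / a_j, so Lagrange
multipliers and homogeneity of degree -1 say that T_{a_j} (p - q)(0) = 0 for one concave quadratic q
with q(0) = p(0), for all nonzero a_j. If four distinct values b occur, then c T_c - d T_d = (c - d) T_c T_d
shows that all iterates T_{b_i} ... T_{b_1} (p - q) vanish at 0. By Rolle's theorem for 1 + b D each of
the four steps back to p - q gains a zero, so p - q has five zeros, and applying the remaining
operators 1 + a_j D keeps five zeros. But after all factors except one positive and one negative a_j
are removed, p has become a two-sided exponential, and its difference with a concave quadratic is
strictly convex on each half-line, so it has at most four zeros.
*)

theory Submission
  imports Defs "HOL-Probability.Distributions" "HOL-Probability.Infinite_Product_Measure"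
    "HOL-Real_Asymp.Real_Asymp"
begin

section \<open>Exponential smoothing\<close>

text \<open>The multiplier condition becomes a condition on T because differentiating s * p(0),
  rather than p(0), in the coordinate s = a_j gives exactly T_{a_j} p(0), where p already contains
  one factor T_{a_j}. Euler's identity fixes one of the two multipliers: the partial derivatives are
  D_j = \<mu> - \<sigma> a_j with \<sigma> = p(0), so that T_{a_j} p(0) = \<sigma> + \<mu> a_j -
  \<sigma> a_j^2. At 0, T_c turns a quadratic into a polynomial of degree two in c, which is the
  origin of q; its concavity is the positivity of \<sigma>.

  The obstacle is regularity. The density of a single cX jumps at 0 and that of a two-sided sum has
  a kink there. So one positive and one negative coordinate, k and l, are merged into a continuous
  kernel, and a third nonzero coordinate i is averaged over before p(0) is differentiated in all
  directions at once. Four distinct nonzero values supply such an i.\<close>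

definition exp_measure :: "real measure" where
  "exp_measure = density lborel (exponential_density 1)"

text \<open>If f is the density of Y, this is the density of Y + c X for an independent standard
  exponential X. Both signs of c occur, and c = 0 gives f back.\<close>

definition smear :: "real \<Rightarrow> (real \<Rightarrow> real) \<Rightarrow> real \<Rightarrow> real" where
  "smear c f x = (\<integral>y. f (x - c * y) \<partial>exp_measure)"

text \<open>Large enough to contain quadratics and bounded continuous densities, small enough to
  exclude the solutions e^(-x/c) of u + c u' = 0. Within this class u + c u' = f has exactly one
  solution for each c \<noteq> 0, namely T_c f.\<close>

definition quad_growth :: "(real \<Rightarrow> real) \<Rightarrow> bool" where
  "quad_growth f \<longleftrightarrow> continuous_on UNIV f \<and> (\<exists>C. \<forall>x. \<bar>f x\<bar> \<le> C * (1 + x\<^sup>2))"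

lemma sets_exp_measure [simp, measurable_cong]: "sets exp_measure = sets borel"
  by (simp add: exp_measure_def)

lemma space_exp_measure [simp]: "space exp_measure = UNIV"
  by (simp add: exp_measure_def)

lemma prob_space_exp_measure: "prob_space exp_measure"
  unfolding exp_measure_def by (rule prob_space_exponential_density) simp

interpretation exp_measure: prob_space exp_measure
  by (rule prob_space_exp_measure)

lemma nn_integral_exp_measure:
  assumes [measurable]: "f \<in> borel_measurable borel"
  shows "(\<integral>\<^sup>+y. f y \<partial>exp_measure) = (\<integral>\<^sup>+y. ennreal (exp (-y)) * indicator {0..} y * f y \<partial>lborel)"
  unfolding exp_measure_def
  by (subst nn_integral_density)
     (auto simp: exponential_density_def split: split_indicator intro!: nn_integral_cong)

lemma integrable_exp_measure_power: "integrable exp_measure (\<lambda>y. y ^ k)"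
proof (rule integrableI_bounded)
  have "(\<integral>\<^sup>+y. ennreal (norm (y ^ k)) \<partial>exp_measure)
      = (\<integral>\<^sup>+y. ennreal (y ^ k * exp (- y)) * indicator {0..} y \<partial>lborel)"
    by (subst nn_integral_exp_measure)
       (auto intro!: nn_integral_cong simp: ennreal_mult'[symmetric] mult.commute split: split_indicator)
  then show "(\<integral>\<^sup>+y. ennreal (norm (y ^ k)) \<partial>exp_measure) < \<infinity>"
    by (simp add: nn_intergal_power_times_exp_Ici)
qed simp

lemma quad_growthD:
  assumes "quad_growth f"
  obtains C where "C \<ge> 0" "\<And>x. \<bar>f x\<bar> \<le> C * (1 + x\<^sup>2)"
proof -
  from assms obtain C where C: "\<And>x. \<bar>f x\<bar> \<le> C * (1 + x\<^sup>2)" by (auto simp: quad_growth_def)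
  have "C \<ge> 0" using C[of 0] by auto
  with C that show ?thesis by blast
qed

lemma quad_growth_measurable [measurable_dest]: "quad_growth f \<Longrightarrow> f \<in> borel_measurable borel"
  by (simp add: quad_growth_def borel_measurable_continuous_onI)

text \<open>Separates x from y: for fixed x the right side is an integrable majorant in y, and after
  integration it bounds the growth in x.\<close>

lemma square_diff_bound: "1 + (x - c * y)\<^sup>2 \<le> (1 + x\<^sup>2) * (2 + 2 * c\<^sup>2 * y\<^sup>2)" for x c y :: real
proof -
  have "(x - c * y)\<^sup>2 \<le> 2 * x\<^sup>2 + 2 * (c * y)\<^sup>2"
    using zero_le_power2[of "x + c * y"] by (simp add: power2_eq_square algebra_simps)
  moreover have "0 \<le> x\<^sup>2 * (c * y)\<^sup>2" by simp
  moreover have "(1 + x\<^sup>2) * (2 + 2 * c\<^sup>2 * y\<^sup>2) = 2 + 2 * x\<^sup>2 + 2 * (c * y)\<^sup>2 + 2 * (x\<^sup>2 * (c * y)\<^sup>2)"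
    by (simp add: algebra_simps)
  ultimately show ?thesis by linarith
qed

lemma integrable_smear_bound: "integrable exp_measure (\<lambda>y. 2 + 2 * c\<^sup>2 * y\<^sup>2)"
  using integrable_exp_measure_power[of 2] by simp

lemma integrable_smear:
  assumes "quad_growth f"
  shows "integrable exp_measure (\<lambda>y. f (x - c * y))"
proof -
  note [measurable] = quad_growth_measurable[OF assms]
  obtain C where C: "C \<ge> 0" "\<And>x. \<bar>f x\<bar> \<le> C * (1 + x\<^sup>2)" using quad_growthD[OF assms] by blast
  have "integrable exp_measure (\<lambda>y. C * ((1 + x\<^sup>2) * (2 + 2 * c\<^sup>2 * y\<^sup>2)))"
    by (intro integrable_mult_right integrable_smear_bound)
  then show ?thesis
  proof (rule Bochner_Integration.integrable_bound)
    show "AE y in exp_measure. norm (f (x - c * y)) \<le> norm (C * ((1 + x\<^sup>2) * (2 + 2 * c\<^sup>2 * y\<^sup>2)))"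
    proof (rule AE_I2)
      fix y
      have "\<bar>f (x - c * y)\<bar> \<le> C * (1 + (x - c * y)\<^sup>2)" by (rule C)
      also have "\<dots> \<le> C * ((1 + x\<^sup>2) * (2 + 2 * c\<^sup>2 * y\<^sup>2))"
        by (intro mult_left_mono square_diff_bound C)
      finally show "norm (f (x - c * y)) \<le> norm (C * ((1 + x\<^sup>2) * (2 + 2 * c\<^sup>2 * y\<^sup>2)))"
        by simp
    qed
  qed measurable
qed

lemma smear_bound:
  assumes "quad_growth f"
  shows "\<exists>C. \<forall>x. \<bar>smear c f x\<bar> \<le> C * (1 + x\<^sup>2)"
proof -
  obtain C where C: "C \<ge> 0" "\<And>x. \<bar>f x\<bar> \<le> C * (1 + x\<^sup>2)" using quad_growthD[OF assms] by blast
  let ?K = "\<integral>y. 2 + 2 * c\<^sup>2 * y\<^sup>2 \<partial>exp_measure"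
  have "\<bar>smear c f x\<bar> \<le> C * ?K * (1 + x\<^sup>2)" for x
  proof -
    have "\<bar>smear c f x\<bar> \<le> (\<integral>y. \<bar>f (x - c * y)\<bar> \<partial>exp_measure)"
      unfolding smear_def by (rule integral_abs_bound)
    also have "\<dots> \<le> (\<integral>y. C * ((1 + x\<^sup>2) * (2 + 2 * c\<^sup>2 * y\<^sup>2)) \<partial>exp_measure)"
    proof (rule integral_mono)
      show "\<bar>f (x - c * y)\<bar> \<le> C * ((1 + x\<^sup>2) * (2 + 2 * c\<^sup>2 * y\<^sup>2))" for y
        using C(2)[of "x - c * y"] mult_left_mono[OF square_diff_bound C(1), of x c y] by linarith
      show "integrable exp_measure (\<lambda>y. \<bar>f (x - c * y)\<bar>)"
        by (intro integrable_abs integrable_smear assms)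
      show "integrable exp_measure (\<lambda>y. C * ((1 + x\<^sup>2) * (2 + 2 * c\<^sup>2 * y\<^sup>2)))"
        by (intro integrable_mult_right integrable_smear_bound)
    qed
    also have "\<dots> = C * ?K * (1 + x\<^sup>2)"
      by (simp only: integral_mult_right_zero mult_ac)
    finally show ?thesis .
  qed
  then show ?thesis by blast
qed

text \<open>Substituting z = x - c y writes T_c f(x) as e^(-x/c) (F(x) - L), where F is an
  antiderivative of f(z) e^(z/c) / c and L its limit at the end of the line where z/c tends to
  -infinity. Both signs of c are covered at once.\<close>

lemma smear_has_derivative:
  assumes f: "quad_growth f" and c: "c \<noteq> 0"
  shows "(smear c f has_real_derivative (f x - smear c f x) / c) (at x)"
proof -
  have cont: "continuous_on UNIV f" using f by (simp add: quad_growth_def)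
  have isf: "isCont f x" for x using cont by (simp add: continuous_on_eq_continuous_at)
  note [measurable] = quad_growth_measurable[OF f]
  obtain F where F: "\<And>x. (F has_vector_derivative f x * exp (x / c) / c) (at x)"
  proof -
    have "isCont (\<lambda>x. f x * exp (x / c) / c) x" for x
      using c by (intro continuous_intros isf) auto
    then show ?thesis
      using einterval_antiderivative[of "-\<infinity>" "\<infinity>" "\<lambda>x. f x * exp (x / c) / c"] that
      by auto
  qed
  have lim: "((\<lambda>N. exp (- x / c) * (F x - F (x - c * N))) \<longlongrightarrow> smear c f x) at_top" for x
  proof -
    let ?g = "\<lambda>y. exponential_density 1 y * f (x - c * y)"
    have int: "integrable lborel ?g"
      using integrable_smear[OF f, of x c] unfolding exp_measure_def
      by (subst (asm) integrable_density) (auto simp: exponential_density_def)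
    have "smear c f x = (\<integral>y. ?g y \<partial>lborel)"
      unfolding smear_def exp_measure_def
      by (subst integral_density) (auto simp: exponential_density_def)
    moreover have "((\<lambda>N. \<integral>y. indicator {..N} y *\<^sub>R ?g y \<partial>lborel) \<longlongrightarrow> (\<integral>y. ?g y \<partial>lborel)) at_top"
      by (rule tendsto_integral_at_top[OF _ int]) simp
    moreover have "(\<integral>y. indicator {..N} y *\<^sub>R ?g y \<partial>lborel) = exp (- x / c) * (F x - F (x - c * N))"
      if "N \<ge> 0" for N
    proof -
      have "(\<integral>y. indicator {..N} y *\<^sub>R ?g y \<partial>lborel) =
            (\<integral>y. indicator {0..N} y *\<^sub>R (exp (- y) * f (x - c * y)) \<partial>lborel)"
        by (intro Bochner_Integration.integral_cong) (auto simp: exponential_density_def split: split_indicator)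
      also have "\<dots> = - exp (- x / c) * F (x - c * N) - (- exp (- x / c) * F (x - c * 0))"
      proof (rule integral_FTC_atLeastAtMost[OF that])
        fix y assume "0 \<le> y" "y \<le> N"
        have "(F has_real_derivative f (x - c * y) * exp ((x - c * y) / c) / c) (at (x - c * y))"
          using F by (simp add: has_real_derivative_iff_has_vector_derivative)
        then have "((\<lambda>y. F (x - c * y)) has_real_derivative
            f (x - c * y) * exp ((x - c * y) / c) / c * (- c)) (at y)"
          by (rule DERIV_chain2) (auto intro!: derivative_eq_intros)
        then have "((\<lambda>y. - exp (- x / c) * F (x - c * y)) has_real_derivative
            - exp (- x / c) * (f (x - c * y) * exp ((x - c * y) / c) / c * (- c))) (at y)"
          by (rule DERIV_cmult)
        also have "- exp (- x / c) * (f (x - c * y) * exp ((x - c * y) / c) / c * (- c))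
            = exp (- y) * f (x - c * y)"
        proof -
          have "exp (- x / c) * exp ((x - c * y) / c) = exp (- y)"
            unfolding mult_exp_exp using c by (simp add: field_simps)
          then show ?thesis using c by (simp add: mult.left_commute[of "exp _" "f _"] mult.assoc[symmetric])
        qed
        finally show "((\<lambda>y. - exp (- x / c) * F (x - c * y)) has_vector_derivative
            exp (- y) * f (x - c * y)) (at y within {0..N})"
          by (simp add: has_real_derivative_iff_has_vector_derivative has_vector_derivative_at_within)
      next
        show "continuous_on {0..N} (\<lambda>y. exp (- y) * f (x - c * y))"
          by (intro continuous_intros continuous_on_compose2[OF cont]) auto
      qed
      finally show ?thesis by (simp add: algebra_simps)
    qed
    ultimately show ?thesis
      by (auto elim!: Lim_transform_eventually intro: eventually_mono[OF eventually_ge_at_top[of 0]])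
  qed
  \<comment> \<open>The existence of the limit of F comes for free from the convergence of the
    truncated integrals at x = 0.\<close>
  define L where "L = F 0 - smear c f 0"
  have L: "((\<lambda>N. F (- c * N)) \<longlongrightarrow> L) at_top"
    using tendsto_diff[OF tendsto_const[of "F 0"] lim[of 0]] by (simp add: L_def)
  have eq: "smear c f x = exp (- x / c) * (F x - L)" for x
  proof (rule tendsto_unique[OF _ lim])
    \<comment> \<open>The limit is carried from x = 0 to arbitrary x by x - c N = - c (N -
      x/c).\<close>
    have "filterlim (\<lambda>N. - x / c + N) at_top at_top"
      by (rule filterlim_tendsto_add_at_top[OF tendsto_const filterlim_ident])
    from filterlim_compose[OF L this]
    have "((\<lambda>N. F (x - c * N)) \<longlongrightarrow> L) at_top" using c by (simp add: algebra_simps)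
    then show "((\<lambda>N. exp (- x / c) * (F x - F (x - c * N))) \<longlongrightarrow> exp (- x / c) * (F x - L)) at_top"
      by (intro tendsto_intros)
  qed simp
  have "((\<lambda>x. exp (- x / c) * (F x - L)) has_real_derivative (f x - smear c f x) / c) (at x)"
    using c F[of x] unfolding eq
    by (auto intro!: derivative_eq_intros simp: has_real_derivative_iff_has_vector_derivative[symmetric]
        field_simps exp_minus)
  moreover have "smear c f = (\<lambda>x. exp (- x / c) * (F x - L))" by (rule ext) (rule eq)
  ultimately show ?thesis by (simp only:)
qed

lemma quad_growth_smear:
  assumes "quad_growth f" "c \<noteq> 0"
  shows "quad_growth (smear c f)"
  using smear_bound[OF assms(1)] smear_has_derivative[OF assms]
  by (auto simp: quad_growth_def intro!: continuous_at_imp_continuous_on DERIV_isCont)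

lemma quad_growth_add: "quad_growth f \<Longrightarrow> quad_growth g \<Longrightarrow> quad_growth (\<lambda>x. f x + g x)"
proof -
  assume f: "quad_growth f" and g: "quad_growth g"
  obtain C where C: "\<And>x. \<bar>f x\<bar> \<le> C * (1 + x\<^sup>2)" using quad_growthD[OF f] by blast
  obtain D where D: "\<And>x. \<bar>g x\<bar> \<le> D * (1 + x\<^sup>2)" using quad_growthD[OF g] by blast
  have "\<bar>f x + g x\<bar> \<le> (C + D) * (1 + x\<^sup>2)" for x
    using C[of x] D[of x] unfolding distrib_right[of C D] by linarith
  then show ?thesis using f g by (auto simp: quad_growth_def intro!: continuous_intros)
qed

lemma quad_growth_cmult: "quad_growth f \<Longrightarrow> quad_growth (\<lambda>x. k * f x)"
proof -
  assume f: "quad_growth f"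
  obtain C where C: "\<And>x. \<bar>f x\<bar> \<le> C * (1 + x\<^sup>2)" using quad_growthD[OF f] by blast
  have "\<bar>k * f x\<bar> \<le> (\<bar>k\<bar> * C) * (1 + x\<^sup>2)" for x
    using mult_left_mono[OF C[of x], of "\<bar>k\<bar>"] by (simp add: abs_mult mult.assoc)
  then show ?thesis using f by (auto simp: quad_growth_def intro!: continuous_intros)
qed

lemma quad_growth_diff: "quad_growth f \<Longrightarrow> quad_growth g \<Longrightarrow> quad_growth (\<lambda>x. f x - g x)"
  using quad_growth_add[OF _ quad_growth_cmult[of g "-1"], of f] by simp

lemma quad_growth_bounded:
  assumes "continuous_on UNIV f" "\<And>x. \<bar>f x\<bar> \<le> C"
  shows "quad_growth f"
proof -
  have "\<bar>f x\<bar> \<le> C * (1 + x\<^sup>2)" for x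
  proof -
    have "0 \<le> C" using assms(2)[of 0] by linarith
    then have "0 \<le> C * x\<^sup>2" by simp
    moreover have "C * (1 + x\<^sup>2) = C + C * x\<^sup>2" by (simp add: algebra_simps)
    ultimately show ?thesis using assms(2)[of x] by linarith
  qed
  then show ?thesis using assms by (auto simp: quad_growth_def)
qed

lemma quad_growth_quadratic: "quad_growth (\<lambda>x. p + q * x + r * x\<^sup>2)"
proof -
  have "quad_growth (\<lambda>x. x\<^sup>2)"
    unfolding quad_growth_def by (auto intro!: continuous_intros exI[of _ 1])
  moreover have "quad_growth (\<lambda>x. x)"
  proof -
    have "\<bar>x\<bar> \<le> 1 * (1 + x\<^sup>2)" for x :: real
      using zero_le_power2[of "\<bar>x\<bar> - 1"] zero_le_power2[of x]
      by (simp add: power2_eq_square algebra_simps)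
    then show ?thesis unfolding quad_growth_def by (intro conjI continuous_intros) blast
  qed
  moreover have "quad_growth (\<lambda>x. p)" by (rule quad_growth_bounded) auto
  ultimately show ?thesis by (intro quad_growth_add quad_growth_cmult)
qed

lemma smear_diff:
  "quad_growth f \<Longrightarrow> quad_growth g \<Longrightarrow> smear c (\<lambda>x. f x - g x) = (\<lambda>x. smear c f x - smear c g x)"
  by (simp add: smear_def fun_eq_iff integrable_smear)

lemma smear_0: "smear 0 f = f"
  using exp_measure.prob_space by (simp add: smear_def fun_eq_iff)

text \<open>Concerns the end of the line where x/c tends to -infinity. It excludes the homogeneous
  solutions, and it acts as a zero at infinity in Rolle's theorem.\<close>

lemma exp_times_quad_growth_tendsto_0:
  assumes "quad_growth f" "c \<noteq> 0"
  shows "((\<lambda>N. exp (- N) * f (- c * N)) \<longlongrightarrow> 0) at_top"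
proof -
  obtain C where C: "C \<ge> 0" "\<And>x. \<bar>f x\<bar> \<le> C * (1 + x\<^sup>2)" using quad_growthD[OF assms(1)] by blast
  have "((\<lambda>N. C * ((1 + c\<^sup>2 * N\<^sup>2) * exp (- N))) \<longlongrightarrow> C * 0) at_top"
    by (intro tendsto_mult_left) real_asymp
  then have lim: "((\<lambda>N. C * ((1 + c\<^sup>2 * N\<^sup>2) * exp (- N))) \<longlongrightarrow> 0) at_top" by simp
  show ?thesis
  proof (rule Lim_null_comparison[OF always_eventually lim], rule allI)
    fix N
    have "exp (- N) * \<bar>f (- c * N)\<bar> \<le> exp (- N) * (C * (1 + (- c * N)\<^sup>2))"
      by (intro mult_left_mono C) auto
    then show "norm (exp (- N) * f (- c * N)) \<le> C * ((1 + c\<^sup>2 * N\<^sup>2) * exp (- N))"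
      by (simp add: abs_mult power_mult_distrib mult_ac)
  qed
qed

text \<open>The difference v of two solutions satisfies v + c v' = 0, so e^(x/c) v is constant, and
  the growth bound forces the constant to be 0. Identities between smears thereby reduce to checking
  a differential equation.\<close>

lemma smear_unique:
  assumes f: "quad_growth f" and u: "quad_growth u" and c: "c \<noteq> 0"
    and D: "\<And>x. (u has_real_derivative (f x - u x) / c) (at x)"
  shows "u = smear c f"
proof -
  define v where "v = (\<lambda>x. u x - smear c f x)"
  have v: "quad_growth v" unfolding v_def by (intro quad_growth_diff u quad_growth_smear f c)
  have Dv: "((\<lambda>x. exp (x / c) * v x) has_real_derivative 0) (at x)" for x
    unfolding v_def using c
    by (auto intro!: derivative_eq_intros D smear_has_derivative f simp: field_simps)
  define K where "K = v 0"
  have K: "exp (x / c) * v x = K" for x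
    using DERIV_isconst_all[OF allI[OF Dv], of x 0] by (simp add: K_def)
  have "((\<lambda>N. exp (- N) * v (- c * N)) \<longlongrightarrow> 0) at_top"
    by (rule exp_times_quad_growth_tendsto_0[OF v c])
  moreover have "exp (- N) * v (- c * N) = K" for N
    using K[of "- c * N"] c by simp
  ultimately have "K = 0" by (simp add: tendsto_const_iff)
  then have "v x = 0" for x using K[of x] by simp
  then show ?thesis by (simp add: v_def fun_eq_iff)
qed

text \<open>After multiplication by (1 + cD)(1 + dD) this is c (1 + dD) - d (1 + cD) = c - d. In the
  proof, the left side divided by c - d is shown to solve u + c u' = T_d f.\<close>

lemma smear_resolvent:
  assumes f: "quad_growth f" and "c \<noteq> 0" "d \<noteq> 0" "c \<noteq> d"
  shows "c * smear c f x - d * smear d f x = (c - d) * smear c (smear d f) x"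
proof -
  define u where "u = (\<lambda>x. (1 / (c - d)) * (c * smear c f x - d * smear d f x))"
  have "u = smear c (smear d f)"
  proof (rule smear_unique)
    show "quad_growth u" unfolding u_def
      by (intro quad_growth_cmult quad_growth_diff quad_growth_smear assms)
    show "(u has_real_derivative (smear d f x - u x) / c) (at x)" for x
    proof -
      have "(u has_real_derivative (1 / (c - d)) * (c * ((f x - smear c f x) / c) - d * ((f x - smear d f x) / d))) (at x)"
        unfolding u_def by (intro DERIV_cmult DERIV_diff smear_has_derivative assms)
      also have "(1 / (c - d)) * (c * ((f x - smear c f x) / c) - d * ((f x - smear d f x) / d))
         = (smear d f x - u x) / c"
        using assms(2-) unfolding u_def by (simp add: field_simps)
      finally show ?thesis .
    qed
  qed (intro quad_growth_smear assms)+
  then have "smear c (smear d f) x = (1 / (c - d)) * (c * smear c f x - d * smear d f x)"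
    by (simp add: u_def fun_eq_iff)
  then show ?thesis using assms(4) by simp
qed

text \<open>The coefficients reflect the moments E X = 1 and E X^2 = 2. The value at 0, as a
  function of c, can be any polynomial of degree at most two.\<close>

lemma smear_quadratic:
  assumes "c \<noteq> 0"
  shows "smear c (\<lambda>x. p + q * x + r * x\<^sup>2) = (\<lambda>x. (p - c * q + 2 * c\<^sup>2 * r) + (q - 2 * c * r) * x + r * x\<^sup>2)"
proof (rule smear_unique[symmetric])
  show "((\<lambda>x. (p - c * q + 2 * c\<^sup>2 * r) + (q - 2 * c * r) * x + r * x\<^sup>2) has_real_derivative
      (p + q * x + r * x\<^sup>2 - ((p - c * q + 2 * c\<^sup>2 * r) + (q - 2 * c * r) * x + r * x\<^sup>2)) / c) (at x)" for x
    using assms by (auto intro!: derivative_eq_intros simp: field_simps power2_eq_square)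
qed (intro quad_growth_quadratic assms)+

text \<open>Vanishing of T_c at 0 is inherited from f by T_d f for every parameter c other than d,
  so an iteration uses up one parameter per step.\<close>

lemma smear_vanishes:
  assumes f: "quad_growth f" and "c \<noteq> 0" "d \<noteq> 0" "c \<noteq> d" "smear c f 0 = 0" "smear d f 0 = 0"
  shows "smear c (smear d f) 0 = 0"
  using smear_resolvent[OF f assms(2-4), of 0] assms by simp

section \<open>Rolle's theorem for first-order operators\<close>

lemma Rolle_zero:
  fixes f :: "real \<Rightarrow> real"
  assumes D: "\<And>x. (f has_real_derivative f' x) (at x)" and "a < b" "f a = f b"
  shows "\<exists>t. a < t \<and> t < b \<and> f' t = 0"
proof -
  have "\<exists>z. a < z \<and> z < b \<and> DERIV f z :> 0"
    using assms(2,3)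
    by (rule Rolle) (meson D DERIV_isCont continuous_at_imp_continuous_on real_differentiable_def)+
  then show ?thesis using DERIV_unique D by blast
qed

text \<open>Rolle's theorem on the half-line below b, with the limit 0 at -infinity in the role of
  the left zero.\<close>

lemma critical_point_below_zero:
  fixes f :: "real \<Rightarrow> real"
  assumes D: "\<And>x. (f has_real_derivative f' x) (at x)" and lim: "(f \<longlongrightarrow> 0) at_bot" and b: "f b = 0"
  shows "\<exists>t<b. f' t = 0"
proof (cases "\<forall>x<b. f x = 0")
  case True
  have "f' (b - 1) = 0"
  proof (rule DERIV_local_const[OF D, of 1])
    show "\<forall>y. \<bar>b - 1 - y\<bar> < 1 \<longrightarrow> f (b - 1) = f y" using True by auto
  qed simp
  then show ?thesis by (intro exI[of _ "b - 1"]) auto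
next
  case False
  then obtain x0 where x0: "x0 < b" "f x0 \<noteq> 0" by auto
  have cont: "continuous_on S f" for S
    using D by (meson DERIV_isCont continuous_at_imp_continuous_on)
  \<comment> \<open>Half of a nonzero value of f is attained on both sides of x0, which replaces the
    zero at infinity by two equal values at finite points.\<close>
  define w where "w = f x0 / 2"
  have "eventually (\<lambda>x. \<bar>f x\<bar> < \<bar>w\<bar>) at_bot"
    using lim x0 unfolding w_def tendsto_iff by (auto simp: dist_real_def dest!: spec[of _ "\<bar>f x0\<bar> / 2"])
  then have "eventually (\<lambda>x. x < x0 \<and> \<bar>f x\<bar> < \<bar>w\<bar>) at_bot"
    using eventually_conj[OF eventually_gt_at_bot] by blast
  then obtain x1 where x1: "x1 < x0" "\<bar>f x1\<bar> < \<bar>w\<bar>"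
    using eventually_happens by fastforce
  have "\<exists>y. x1 \<le> y \<and> y \<le> x0 \<and> f y = w"
  proof (cases "f x0 > 0")
    case True then show ?thesis using x1 x0 by (intro IVT' cont) (auto simp: w_def)
  next
    case False then show ?thesis using x1 x0 by (intro IVT2' cont) (auto simp: w_def)
  qed
  then obtain y where y: "x1 \<le> y" "y \<le> x0" "f y = w" by blast
  have "\<exists>z. x0 \<le> z \<and> z \<le> b \<and> f z = w"
  proof (cases "f x0 > 0")
    case True then show ?thesis using x0 b by (intro IVT2' cont) (auto simp: w_def)
  next
    case False then show ?thesis using x0 b by (intro IVT' cont) (auto simp: w_def)
  qed
  then obtain z where z: "x0 \<le> z" "z \<le> b" "f z = w" by blast
  have "w \<noteq> 0" "f x0 \<noteq> w" using x0 by (auto simp: w_def)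
  then have "y < x0" "x0 < z" "z < b" using y z b x0 by (auto simp: less_le)
  then have "\<exists>t. y < t \<and> t < z \<and> f' t = 0"
    using y z by (intro Rolle_zero[OF D]) auto
  then show ?thesis using \<open>z < b\<close> by (meson order.strict_trans)
qed

text \<open>The interlacing zeros of the derivative avoid the given ones, which is what makes a chain of
  these steps gain a zero as long as all iterates vanish at one common point.\<close>
lemma Rolle_from_bottom:
  fixes f :: "real \<Rightarrow> real"
  assumes D: "\<And>x. (f has_real_derivative f' x) (at x)" and lim: "(f \<longlongrightarrow> 0) at_bot"
    and "finite S" and "\<And>x. x \<in> S \<Longrightarrow> f x = 0"
  shows "\<exists>T. finite T \<and> card T = card S \<and> T \<inter> S = {} \<and> (\<forall>t\<in>T. f' t = 0)"
proof -
  have "\<exists>T. finite T \<and> card T = card S \<and> T \<inter> S = {} \<and> (\<forall>t\<in>T. f' t = 0 \<and> (\<exists>s\<in>S. t < s))"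
    using assms(3,4)
  proof (induction S rule: finite_linorder_max_induct)
    case empty then show ?case by auto
  next
    case (insert b A)
    then obtain T where T: "finite T" "card T = card A" "T \<inter> A = {}" "\<forall>t\<in>T. f' t = 0 \<and> (\<exists>s\<in>A. t < s)"
      by auto
    have "\<exists>t<b. f' t = 0 \<and> (\<forall>s\<in>A. s < t)"
    proof (cases "A = {}")
      case True
      then show ?thesis using critical_point_below_zero[OF D lim, of b] insert.prems by auto
    next
      case False
      then have M: "Max A \<in> A" "\<And>s. s \<in> A \<Longrightarrow> s \<le> Max A" using insert.hyps by auto
      have "\<exists>t. Max A < t \<and> t < b \<and> f' t = 0"
        using M insert.hyps insert.prems by (intro Rolle_zero[OF D]) auto
      then show ?thesis using M by force
    qed
    then obtain t where t: "t < b" "f' t = 0" "\<forall>s\<in>A. s < t" by blast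
    have tT: "t \<notin> T" using T(4) t(3) by force
    have "card (insert t T) = card (insert b A)"
      using T tT insert.hyps by (auto simp: card_insert_if)
    moreover have "insert t T \<inter> insert b A = {}"
      using T t insert.hyps by force
    ultimately show ?case
      using T t by (intro exI[of _ "insert t T"]) auto
  qed
  then show ?thesis by blast
qed

text \<open>Here g = f + c f'. The function e^N f(c N) has derivative e^N g(c N) and tends to 0 at
  -infinity; the rescaling by c sends both signs of c to the same end of the line.\<close>

lemma zeros_first_order_operator:
  fixes f :: "real \<Rightarrow> real"
  assumes f: "quad_growth f" and c: "c \<noteq> 0"
    and D: "\<And>x. (f has_real_derivative (g x - f x) / c) (at x)"
    and S: "finite S" "\<And>x. x \<in> S \<Longrightarrow> f x = 0"
  shows "\<exists>T. finite T \<and> card T = card S \<and> T \<inter> S = {} \<and> (\<forall>t\<in>T. g t = 0)"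
proof -
  define F where "F = (\<lambda>N. exp N * f (c * N))"
  have "\<exists>T. finite T \<and> card T = card ((\<lambda>x. x / c) ` S) \<and> T \<inter> (\<lambda>x. x / c) ` S = {} \<and> (\<forall>t\<in>T. exp t * g (c * t) = 0)"
  proof (rule Rolle_from_bottom)
    show "(F has_real_derivative exp x * g (c * x)) (at x)" for x
      unfolding F_def using c
      by (auto intro!: derivative_eq_intros DERIV_chain2[OF D] simp: field_simps)
    show "(F \<longlongrightarrow> 0) at_bot"
      using exp_times_quad_growth_tendsto_0[OF f c] unfolding F_def filterlim_at_bot_mirror by simp
    show "finite ((\<lambda>x. x / c) ` S)" "\<And>x. x \<in> (\<lambda>x. x / c) ` S \<Longrightarrow> F x = 0"
      using S c by (auto simp: F_def)
  qed
  then obtain T where T: "finite T" "card T = card ((\<lambda>x. x / c) ` S)" "T \<inter> (\<lambda>x. x / c) ` S = {}"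
    "\<And>t. t \<in> T \<Longrightarrow> g (c * t) = 0" by auto
  have "card ((*) c ` T) = card S"
    using T(2) c by (subst card_image) (auto simp: inj_on_def card_image)
  moreover have "(*) c ` T \<inter> S = {}"
    using T(3) c by force
  ultimately show ?thesis using T by (intro exI[of _ "(*) c ` T"]) auto
qed

lemma zeros_smear:
  assumes "quad_growth f" "c \<noteq> 0" "finite S" "\<And>x. x \<in> S \<Longrightarrow> smear c f x = 0"
  shows "\<exists>T. finite T \<and> card T = card S \<and> T \<inter> S = {} \<and> (\<forall>t\<in>T. f t = 0)"
  by (rule zeros_first_order_operator[OF quad_growth_smear[OF assms(1,2)] assms(2)
        smear_has_derivative[OF assms(1,2)] assms(3,4)])

text \<open>The zeros supplied by Rolle's theorem avoid S, which contains 0; as f also vanishes at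
  0, this point is an additional zero.\<close>

lemma zeros_smear_gain:
  assumes "quad_growth f" "c \<noteq> 0" "f 0 = 0" "finite S" "0 \<in> S" "\<And>x. x \<in> S \<Longrightarrow> smear c f x = 0"
  shows "\<exists>T. finite T \<and> card T = Suc (card S) \<and> 0 \<in> T \<and> (\<forall>t\<in>T. f t = 0)"
proof -
  have "\<exists>T. finite T \<and> card T = card S \<and> T \<inter> S = {} \<and> (\<forall>t\<in>T. f t = 0)"
    by (rule zeros_smear[OF assms(1,2,4,6)])
  then obtain T where "finite T" "card T = card S" "T \<inter> S = {}" "\<forall>t\<in>T. f t = 0"
    by blast
  then show ?thesis using assms by (intro exI[of _ "insert 0 T"]) (auto simp: card_insert_if)
qed

text \<open>The count is 1 + 4: the fourth iterate is only known to vanish at 0, and each of the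
  four steps back adds one zero. The gain repeats because every iterate vanishes at the same point
  0, which is where the four parameters have to be distinct.\<close>

lemma five_zeros:
  assumes r: "quad_growth r" "r 0 = 0" and B: "card B = 4" "0 \<notin> B" "\<And>b. b \<in> B \<Longrightarrow> smear b r 0 = 0"
  shows "\<exists>S. finite S \<and> card S = 5 \<and> (\<forall>x\<in>S. r x = 0)"
proof -
  obtain b1 b2 b3 b4 where b: "B = {b1, b2, b3, b4}"
     "b1 \<noteq> b2" "b1 \<noteq> b3" "b1 \<noteq> b4" "b2 \<noteq> b3" "b2 \<noteq> b4" "b3 \<noteq> b4"
  proof -
    obtain b1 B1 where 1: "B = insert b1 B1" "b1 \<notin> B1" "card B1 = 3"
      using B(1) card_eq_SucD[of B 3] by auto
    then show ?thesis using that card_3_iff[THEN iffD1, OF 1(3)] by fastforce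
  qed
  have nz: "b1 \<noteq> 0" "b2 \<noteq> 0" "b3 \<noteq> 0" "b4 \<noteq> 0" using B(2) b(1) by auto
  define r1 where "r1 = smear b1 r"
  define r2 where "r2 = smear b2 r1"
  define r3 where "r3 = smear b3 r2"
  define r4 where "r4 = smear b4 r3"
  have q: "quad_growth r1" "quad_growth r2" "quad_growth r3"
    unfolding r1_def r2_def r3_def by (intro quad_growth_smear r nz)+
  have s0: "smear b1 r 0 = 0" "smear b2 r 0 = 0" "smear b3 r 0 = 0" "smear b4 r 0 = 0"
    using B(3) b(1) by auto
  have s1: "smear x r1 0 = 0" if "x \<in> {b2, b3, b4}" for x
    unfolding r1_def using that s0 b nz r by (intro smear_vanishes) auto
  have s2: "smear x r2 0 = 0" if "x \<in> {b3, b4}" for x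
    unfolding r2_def using that s1 b nz q by (intro smear_vanishes) auto
  have s3: "smear b4 r3 0 = 0"
    unfolding r3_def using s2 b nz q by (intro smear_vanishes) auto
  have z: "r1 0 = 0" "r2 0 = 0" "r3 0 = 0" "r4 0 = 0"
    using s0 s1 s2 s3 by (auto simp: r1_def r2_def r3_def r4_def)
  have "\<exists>T. finite T \<and> card T = Suc (card {0::real}) \<and> 0 \<in> T \<and> (\<forall>t\<in>T. r3 t = 0)"
    using z q nz by (intro zeros_smear_gain[of r3 b4]) (auto simp: r4_def)
  then obtain S3 where S3: "finite S3" "card S3 = 2" "0 \<in> S3" "\<forall>t\<in>S3. r3 t = 0" by auto
  have "\<exists>T. finite T \<and> card T = Suc (card S3) \<and> 0 \<in> T \<and> (\<forall>t\<in>T. r2 t = 0)"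
    using z q nz S3 by (intro zeros_smear_gain[of r2 b3]) (auto simp: r3_def)
  then obtain S2 where S2: "finite S2" "card S2 = 3" "0 \<in> S2" "\<forall>t\<in>S2. r2 t = 0" using S3 by auto
  have "\<exists>T. finite T \<and> card T = Suc (card S2) \<and> 0 \<in> T \<and> (\<forall>t\<in>T. r1 t = 0)"
    using z q nz S2 by (intro zeros_smear_gain[of r1 b2]) (auto simp: r2_def)
  then obtain S1 where S1: "finite S1" "card S1 = 4" "0 \<in> S1" "\<forall>t\<in>S1. r1 t = 0" using S2 by auto
  have "\<exists>T. finite T \<and> card T = Suc (card S1) \<and> 0 \<in> T \<and> (\<forall>t\<in>T. r t = 0)"
    using z r nz S1 by (intro zeros_smear_gain[of r b1]) (auto simp: r1_def)
  then show ?thesis using S1 by auto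
qed

section \<open>Mixtures of independent exponential variables\<close>

text \<open>Density of c X, for c \<noteq> 0 of either sign. At the jump the larger value is taken,
  in pointwise agreement with the closed orthant in \<open>cone_weight\<close>.\<close>

definition one_sided :: "real \<Rightarrow> real \<Rightarrow> real" where
  "one_sided c x = (if 0 \<le> x / c then exp (- x / c) / \<bar>c\<bar> else 0)"

text \<open>For d < 0 < c this is the density of c X + d Y with X, Y independent standard
  exponential. The maximum is x/c for x \<ge> 0 and x/d for x \<le> 0, and in this form continuity
  at 0 takes no case distinction.\<close>

definition two_sided :: "real \<Rightarrow> real \<Rightarrow> real \<Rightarrow> real" where
  "two_sided c d x = exp (- max (x / c) (x / d)) / (c - d)"

text \<open>If f is the density of Y, this is the density of Y plus the sum of a_j X_j over J. A
  single product integral, rather than iterated smears, allows all coefficients to vary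
  simultaneously in a directional derivative.\<close>

definition mix :: "('i \<Rightarrow> real) \<Rightarrow> 'i set \<Rightarrow> (real \<Rightarrow> real) \<Rightarrow> real \<Rightarrow> real" where
  "mix a J f x = (\<integral>y. f (x - (\<Sum>j\<in>J. a j * y j)) \<partial>(\<Pi>\<^sub>M j\<in>J. exp_measure))"

lemma one_sided_measurable [measurable]: "one_sided c \<in> borel_measurable borel"
  unfolding one_sided_def by measurable

lemma one_sided_bounds: "0 \<le> one_sided c x" "one_sided c x \<le> 1 / \<bar>c\<bar>"
  by (auto simp: one_sided_def intro!: divide_right_mono)

lemma isCont_one_sided:
  assumes "x \<noteq> 0" "c \<noteq> 0"
  shows "isCont (one_sided c) x"
proof -
  have op: "open {x. 0 < x / c}" "open {x. x / c < 0}"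
    by (intro open_Collect_less continuous_intros; use assms in simp)+
  show ?thesis
  proof (cases "0 < x / c")
    case True
    have "\<forall>\<^sub>F y in nhds x. one_sided c y = exp (- y / c) / \<bar>c\<bar>"
    proof (rule eventually_mono)
      show "\<forall>\<^sub>F y in nhds x. y \<in> {x. 0 < x / c}" using op(1) True by (intro eventually_nhds_in_open) auto
    qed (simp only: one_sided_def less_imp_le if_True mem_Collect_eq)
    moreover have "isCont (\<lambda>y. exp (- y / c) / \<bar>c\<bar>) x" using assms by (intro continuous_intros) auto
    ultimately show ?thesis by (subst isCont_cong)
  next
    case False
    then have neg: "x / c < 0" using assms by (simp add: not_less less_le)
    have "\<forall>\<^sub>F y in nhds x. one_sided c y = 0"
    proof (rule eventually_mono)
      show "\<forall>\<^sub>F y in nhds x. y \<in> {x. x / c < 0}" using op(2) neg by (intro eventually_nhds_in_open) auto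
    qed (simp only: one_sided_def not_le[symmetric] if_False mem_Collect_eq)
    moreover have "isCont (\<lambda>y. 0 :: real) x" by simp
    ultimately show ?thesis by (subst isCont_cong)
  qed
qed

lemma two_sided_continuous: "c \<noteq> 0 \<Longrightarrow> d \<noteq> 0 \<Longrightarrow> c \<noteq> d \<Longrightarrow> continuous_on UNIV (two_sided c d)"
  unfolding two_sided_def by (intro continuous_intros) auto

lemma max_div_nonneg:
  fixes x c d :: real
  assumes "0 < c" "d < 0"
  shows "0 \<le> max (x / c) (x / d)"
  using assms by (cases "x \<ge> 0") (auto simp: le_max_iff_disj divide_nonneg_pos divide_nonpos_neg)

lemma two_sided_bounds:
  assumes "0 < c" "d < 0"
  shows "0 < two_sided c d x" "two_sided c d x \<le> 1 / (c - d)"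
  using assms max_div_nonneg[OF assms, of x] by (auto simp: two_sided_def intro!: divide_right_mono)

lemma nn_integral_one_sided:
  assumes c: "0 < c" and d: "d < 0"
  shows "(\<integral>\<^sup>+y. ennreal (one_sided c (x - d * y)) \<partial>exp_measure) = ennreal (two_sided c d x)"
proof -
  \<comment> \<open>The rate k collects the decay of e^(-y) and of e^(d y/c). Since d < 0, the
    argument x - d y is nonnegative exactly from y = x/d on, whence the lower limit m.\<close>
  define k where "k = (c - d) / c"
  define m where "m = max 0 (x / d)"
  have k: "0 < k" using c d by (simp add: k_def)
  have "(\<integral>\<^sup>+y. ennreal (one_sided c (x - d * y)) \<partial>exp_measure) =
      (\<integral>\<^sup>+y. ennreal (exp (- x / c) / c * exp (- k * y)) * indicator {m..} y \<partial>lborel)"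
  proof (subst nn_integral_exp_measure, measurable, rule nn_integral_cong)
    fix y
    have "0 \<le> (x - d * y) / c \<longleftrightarrow> x / d \<le> y" using c d by (simp add: field_simps)
    moreover have "exp (- y) * (exp (- (x - d * y) / c) / \<bar>c\<bar>) = exp (- x / c) / c * exp (- k * y)"
      using c by (simp add: k_def exp_add[symmetric] field_simps)
    ultimately show "ennreal (exp (- y)) * indicator {0..} y * ennreal (one_sided c (x - d * y)) =
        ennreal (exp (- x / c) / c * exp (- k * y)) * indicator {m..} y"
      using c by (auto simp: one_sided_def m_def ennreal_mult'[symmetric] split: split_indicator)
  qed
  also have "\<dots> = ennreal (0 - (- (exp (- x / c) / c * exp (- k * m) / k)))"
  proof (rule nn_integral_FTC_atLeast)
    show "((\<lambda>y. - (exp (- x / c) / c * exp (- k * y) / k)) has_real_derivative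
        exp (- x / c) / c * exp (- k * y)) (at y)" for y
      using k c by (auto intro!: derivative_eq_intros)
    have "((\<lambda>y. exp (- k * y)) \<longlongrightarrow> 0) at_top" using k by real_asymp
    from tendsto_mult_left[OF this, of "- (exp (- x / c) / c / k)"]
    show "((\<lambda>y. - (exp (- x / c) / c * exp (- k * y) / k)) \<longlongrightarrow> 0) at_top" by simp
  qed (use c in auto)
  also have "0 - (- (exp (- x / c) / c * exp (- k * m) / k)) = two_sided c d x"
  proof -
    have ck: "c - d = c * k" using c by (simp add: k_def)
    have "0 - (- (exp (- x / c) / c * exp (- k * m) / k)) = (exp (- x / c) * exp (- k * m)) / (c - d)"
      unfolding ck by simp
    also have "exp (- x / c) * exp (- k * m) = exp (- x / c - k * m)"
      unfolding mult_exp_exp by simp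
    finally have "0 - (- (exp (- x / c) / c * exp (- k * m) / k)) = exp (- x / c - k * m) / (c - d)" .
    also have "- x / c - k * m = - max (x / c) (x / d)"
    proof (cases "0 \<le> x")
      case True
      then have "x / d \<le> 0" "0 \<le> x / c" using c d by (auto simp: divide_nonneg_neg)
      then have "max (x / c) (x / d) = x / c" "m = 0" by (auto simp: m_def)
      then show ?thesis by simp
    next
      case False
      then have "0 < x / d" "x / c < 0" using c d by (auto simp: divide_neg_neg divide_neg_pos)
      moreover have "- x / c - k * (x / d) = - (x / d)" using c d by (simp add: k_def field_simps)
      moreover have "max (x / c) (x / d) = x / d" "m = x / d" using calculation by (auto simp: m_def)
      ultimately show ?thesis by simp
    qed
    finally show ?thesis by (simp add: two_sided_def)
  qed
  finally show ?thesis .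
qed

lemma smear_one_sided:
  assumes c: "0 < c" and d: "d < 0"
  shows "smear d (one_sided c) = two_sided c d"
proof
  fix x
  show "smear d (one_sided c) x = two_sided c d x"
    unfolding smear_def
    by (subst integral_eq_nn_integral)
       (auto simp: nn_integral_one_sided[OF assms] one_sided_bounds two_sided_bounds[OF assms] less_imp_le)
qed

text \<open>Reflection at the origin exchanges the two signs and reduces this to the previous
  case.\<close>

lemma smear_one_sided':
  assumes c: "0 < c" and d: "d < 0"
  shows "smear c (one_sided d) = two_sided c d"
proof
  fix x
  have "one_sided d z = one_sided (- d) (- z)" for z
    by (simp add: one_sided_def)
  then have "smear c (one_sided d) x = smear (- c) (one_sided (- d)) (- x)"
    by (simp add: smear_def)
  also have "\<dots> = two_sided c d x"
    using smear_one_sided[of "- d" "- c"] assms by (simp add: two_sided_def max.commute)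
  finally show "smear c (one_sided d) x = two_sided c d x" .
qed

section \<open>Mixtures as integrals over a product of exponential laws\<close>

interpretation expP: product_sigma_finite "\<lambda>_. exp_measure"
  by standard

lemma integrable_bounded_prob:
  fixes g :: "'a \<Rightarrow> real"
  assumes "prob_space M" "g \<in> borel_measurable M" "\<And>x. \<bar>g x\<bar> \<le> C"
  shows "integrable M g"
proof -
  interpret prob_space M by fact
  show ?thesis by (rule integrable_const_bound[of _ C]) (use assms in auto)
qed

lemma prob_PiM_exp: "prob_space (\<Pi>\<^sub>M j\<in>J. exp_measure)"
  by (intro prob_space_PiM prob_space_exp_measure)

lemma mix_integrand_measurable [measurable]:
  assumes [measurable]: "f \<in> borel_measurable borel"
  shows "(\<lambda>y. f (x - (\<Sum>j\<in>J. a j * y j))) \<in> borel_measurable (\<Pi>\<^sub>M j\<in>J. exp_measure)"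
  by measurable

lemma mix_integrable:
  fixes f :: "real \<Rightarrow> real"
  assumes "f \<in> borel_measurable borel" "\<And>x. \<bar>f x\<bar> \<le> C"
  shows "integrable (\<Pi>\<^sub>M j\<in>J. exp_measure) (\<lambda>y. f (x - (\<Sum>j\<in>J. a j * y j)))"
proof (rule integrable_bounded_prob)
  show "prob_space (\<Pi>\<^sub>M j\<in>J. exp_measure)" by (rule prob_PiM_exp)
qed (use assms in auto)

lemma mix_empty: "mix a {} f = f"
proof
  fix x
  interpret prob_space "\<Pi>\<^sub>M j\<in>{}. exp_measure" by (rule prob_PiM_exp)
  show "mix a {} f x = f x" unfolding mix_def by (simp add: prob_space)
qed

lemma mix_cong: "(\<And>j. j \<in> J \<Longrightarrow> a j = b j) \<Longrightarrow> mix a J f = mix b J f"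
  unfolding mix_def by (simp cong: sum.cong)

lemma smear_bounded:
  assumes "\<And>x. \<bar>f x\<bar> \<le> C" "f \<in> borel_measurable borel"
  shows "\<bar>smear c f x\<bar> \<le> C"
proof -
  have "\<bar>smear c f x\<bar> \<le> (\<integral>y. \<bar>f (x - c * y)\<bar> \<partial>exp_measure)"
    unfolding smear_def by (rule integral_abs_bound)
  also have "\<dots> \<le> (\<integral>y. C \<partial>exp_measure)"
    using assms by (intro integral_mono integrable_abs integrable_bounded_prob[OF prob_space_exp_measure]) auto
  finally show ?thesis using exp_measure.prob_space by simp
qed

lemma mix_bounded:
  assumes "\<And>x. \<bar>f x\<bar> \<le> C" "f \<in> borel_measurable borel"
  shows "\<bar>mix a J f x\<bar> \<le> C"
proof -
  interpret prob_space "\<Pi>\<^sub>M j\<in>J. exp_measure" by (rule prob_PiM_exp)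
  have "\<bar>mix a J f x\<bar> \<le> (\<integral>y. \<bar>f (x - (\<Sum>j\<in>J. a j * y j))\<bar> \<partial>(\<Pi>\<^sub>M j\<in>J. exp_measure))"
    unfolding mix_def by (rule integral_abs_bound)
  also have "\<dots> \<le> (\<integral>y. C \<partial>(\<Pi>\<^sub>M j\<in>J. exp_measure))"
    using assms by (intro integral_mono integrable_abs mix_integrable) auto
  finally show ?thesis by (simp add: prob_space)
qed

lemma sum_insert_upd:
  assumes "finite J" "j \<notin> J"
  shows "(\<Sum>i\<in>insert j J. a i * (y(j := z)) i) = (\<Sum>i\<in>J. a i * y i) + a j * z"
proof -
  have "(\<Sum>i\<in>J. a i * (y(j := z)) i) = (\<Sum>i\<in>J. a i * y i)"
    using assms by (intro sum.cong) auto
  then show ?thesis using assms by (simp add: add.commute)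
qed

lemma mix_insert_inner:
  assumes "finite J" "j \<notin> J" and f: "f \<in> borel_measurable borel" "\<And>x. \<bar>f x\<bar> \<le> C"
  shows "mix a (insert j J) f = mix a J (smear (a j) f)"
proof
  fix x
  show "mix a (insert j J) f x = mix a J (smear (a j) f) x"
    unfolding mix_def smear_def
    by (subst expP.product_integral_insert[OF assms(1,2) mix_integrable[OF f]])
       (simp only: sum_insert_upd[OF assms(1,2)] diff_diff_eq)
qed

text \<open>The new coordinate is smoothed last instead of first; f is bounded and the measures are
  probabilities, so Fubini applies. This form exhibits a density as T applied to the density with
  one coordinate removed.\<close>

lemma mix_insert_outer:
  assumes "finite J" "j \<notin> J" and f: "f \<in> borel_measurable borel" "\<And>x. \<bar>f x\<bar> \<le> C"
  shows "mix a (insert j J) f = smear (a j) (mix a J f)"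
proof
  fix x
  note f(1)[measurable]
  interpret J: prob_space "\<Pi>\<^sub>M j\<in>J. exp_measure" by (rule prob_PiM_exp)
  interpret pair_prob_space "\<Pi>\<^sub>M j\<in>J. exp_measure" exp_measure by standard
  have "mix a (insert j J) f x = mix a J (smear (a j) f) x"
    by (simp add: mix_insert_inner[OF assms])
  also have "\<dots> = smear (a j) (mix a J f) x"
  proof -
    have "integrable ((\<Pi>\<^sub>M j\<in>J. exp_measure) \<Otimes>\<^sub>M exp_measure)
        (case_prod (\<lambda>y z. f (x - (\<Sum>j\<in>J. a j * y j) - a j * z)))"
      by (rule integrable_bounded_prob[where C = C]) (auto intro!: f prob_space_axioms)
    from Fubini_integral[OF this] show ?thesis
      unfolding mix_def smear_def by (simp only: cancel_ab_semigroup_add_class.diff_right_commute[of x])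
  qed
  finally show "mix a (insert j J) f x = smear (a j) (mix a J f) x" .
qed

text \<open>For fixed values of the other coordinates only one value of \<open>y j\<close> is
  excluded, and the exponential law has no atoms.\<close>

lemma AE_sum_exp_neq:
  assumes J: "finite J" "j \<in> J" "a j \<noteq> 0"
  shows "AE y in (\<Pi>\<^sub>M j\<in>J. exp_measure). x - (\<Sum>j\<in>J. a j * y j) \<noteq> 0"
proof -
  let ?M = "\<lambda>J. \<Pi>\<^sub>M j\<in>J. exp_measure"
  define K where "K = J - {j}"
  have JK: "J = insert j K" "finite K" "j \<notin> K" using J by (auto simp: K_def)
  have "emeasure exp_measure {z} = 0" for z
    unfolding exp_measure_def by (subst emeasure_density) (auto simp: nn_integral_0_iff_AE AE_lborel_singleton intro!: AE_I'[of "{z}"] split: split_indicator)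
  then have 0: "(\<integral>\<^sup>+z. indicator {z. x - (s + a j * z) = 0} z \<partial>exp_measure) = 0" for s
  proof -
    have "{z. x - (s + a j * z) = 0} = {(x - s) / a j}" using J by (auto simp: field_simps)
    then show ?thesis using \<open>\<And>z. emeasure exp_measure {z} = 0\<close> by simp
  qed
  have "(\<integral>\<^sup>+y. indicator {y. x - (\<Sum>j\<in>J. a j * y j) = 0} y \<partial>?M J)
      = (\<integral>\<^sup>+y. (\<integral>\<^sup>+z. indicator {y. x - (\<Sum>j\<in>J. a j * y j) = 0} (y(j := z)) \<partial>exp_measure) \<partial>?M K)"
    unfolding JK(1) by (rule expP.product_nn_integral_insert[OF JK(2,3)]) (simp add: indicator_def)
  also have "\<dots> = (\<integral>\<^sup>+y. (\<integral>\<^sup>+z. indicator {z. x - ((\<Sum>j\<in>K. a j * y j) + a j * z) = 0} z \<partial>exp_measure) \<partial>?M K)"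
    unfolding indicator_def mem_Collect_eq unfolding JK(1) sum_insert_upd[OF JK(2,3)] ..
  also have "\<dots> = 0" by (simp only: 0) simp
  finally have "AE y in ?M J. (indicator {y. x - (\<Sum>j\<in>J. a j * y j) = 0} y :: ennreal) = 0"
    by (subst (asm) nn_integral_0_iff_AE) (auto simp: indicator_def)
  then show ?thesis by (auto simp: indicator_def)
qed

text \<open>Dominated convergence with the constant C. A jump of f at 0, as in
  \<open>one_sided\<close>, is harmless once some a_j is nonzero, because the argument then hits 0
  with probability 0.\<close>

lemma mix_continuous:
  assumes f: "f \<in> borel_measurable borel" "\<And>x. \<bar>f x\<bar> \<le> C" and "finite J"
    and cont: "\<And>x. x \<noteq> 0 \<Longrightarrow> isCont f x"
    and nz: "isCont f 0 \<or> (\<exists>j\<in>J. a j \<noteq> 0)"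
  shows "continuous_on UNIV (mix a J f)"
proof -
  note f(1)[measurable]
  let ?M = "\<Pi>\<^sub>M j\<in>J. exp_measure"
  interpret J: prob_space ?M by (rule prob_PiM_exp)
  have "isCont (mix a J f) x" for x
  proof (subst continuous_at_sequentially, intro allI impI)
    fix u :: "nat \<Rightarrow> real" assume u: "u \<longlonglongrightarrow> x"
    have "AE y in ?M. isCont f (x - (\<Sum>j\<in>J. a j * y j))"
      using nz
    proof
      assume "isCont f 0"
      then have "isCont f z" for z using cont by (cases "z = 0") auto
      then show ?thesis by auto
    next
      assume "\<exists>j\<in>J. a j \<noteq> 0"
      then obtain j where "j \<in> J" "a j \<noteq> 0" by blast
      from AE_sum_exp_neq[where a = a, OF \<open>finite J\<close> this, of x] show ?thesis
        by eventually_elim (rule cont)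
    qed
    then have "AE y in ?M. (\<lambda>n. f (u n - (\<Sum>j\<in>J. a j * y j))) \<longlonglongrightarrow> f (x - (\<Sum>j\<in>J. a j * y j))"
      by eventually_elim (erule isCont_tendsto_compose, intro tendsto_intros u)
    then have "(\<lambda>n. mix a J f (u n)) \<longlonglongrightarrow> mix a J f x"
      unfolding mix_def
      by (rule integral_dominated_convergence[where w = "\<lambda>_. C", rotated 3]) (use f(2) in auto)
    then show "(mix a J f \<circ> u) \<longlonglongrightarrow> mix a J f x" by (simp add: o_def)
  qed
  then show ?thesis by (simp add: continuous_at_imp_continuous_on)
qed

lemma mix_quad_growth:
  assumes f: "f \<in> borel_measurable borel" "\<And>x. \<bar>f x\<bar> \<le> C" and "finite J"
    and cont: "\<And>x. x \<noteq> 0 \<Longrightarrow> isCont f x"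
    and nz: "isCont f 0 \<or> (\<exists>j\<in>J. a j \<noteq> 0)"
  shows "quad_growth (mix a J f)"
  by (rule quad_growth_bounded[OF mix_continuous[OF assms] mix_bounded[OF f(2,1)]])

lemma two_sided_mix:
  assumes cd: "0 < c" "d < 0" and J: "finite J"
  shows "quad_growth (mix a J (two_sided c d))" "\<bar>mix a J (two_sided c d) x\<bar> \<le> 1 / (c - d)"
proof -
  have c: "continuous_on UNIV (two_sided c d)" using cd by (intro two_sided_continuous) auto
  then have m: "two_sided c d \<in> borel_measurable borel" by (rule borel_measurable_continuous_onI)
  have b: "\<bar>two_sided c d x\<bar> \<le> 1 / (c - d)" for x using two_sided_bounds[OF cd, of x] by auto
  show "quad_growth (mix a J (two_sided c d))"
    using c by (intro mix_quad_growth[OF m b J]) (auto simp: continuous_on_eq_continuous_at)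
  show "\<bar>mix a J (two_sided c d) x\<bar> \<le> 1 / (c - d)"
    by (rule mix_bounded[OF b m])
qed

lemma two_sided_mix_insert:
  assumes cd: "0 < c" "d < 0" and J: "finite J" "j \<notin> J"
  shows "mix a (insert j J) (two_sided c d) = smear (a j) (mix a J (two_sided c d))"
proof (rule mix_insert_outer[OF J])
  have "continuous_on UNIV (two_sided c d)" using cd by (intro two_sided_continuous) auto
  then show "two_sided c d \<in> borel_measurable borel" by (rule borel_measurable_continuous_onI)
  show "\<bar>two_sided c d x\<bar> \<le> 1 / (c - d)" for x using two_sided_bounds[OF cd, of x] by auto
qed

section \<open>Zeros of a mixture minus a concave quadratic\<close>

lemma exp_minus_quadratic_zeros:
  fixes k p q r :: real
 assumes "0 < k" "r < 0" "c \<noteq> 0" "finite S" "\<And>x. x \<in> S \<Longrightarrow> k * exp (- x / c) = p + q * x + r * x\<^sup>2"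
  shows "card S \<le> 2"
proof (rule ccontr)
  assume "\<not> card S \<le> 2"
  then obtain S' where S': "S' \<subseteq> S" "card S' = 3" "finite S'"
    using obtain_subset_with_card_n[of 3 S] by auto
  define F where "F = (\<lambda>x. k * exp (- x / c) - p - q * x - r * x\<^sup>2)"
  define F' where "F' = (\<lambda>x. - k / c * exp (- x / c) - q - 2 * r * x)"
  define F'' where "F'' = (\<lambda>x. k / c\<^sup>2 * exp (- x / c) - 2 * r)"
  have D: "(F has_real_derivative F' x) (at x)" "(F' has_real_derivative F'' x) (at x)" for x
    unfolding F_def F'_def F''_def
    using assms by (auto intro!: derivative_eq_intros simp: power2_eq_square)
  define x where "x = Min S'"
  define z where "z = Max S'"
  have "x \<in> S'" "z \<in> S'" using S' unfolding x_def z_def by (auto intro!: Min_in Max_in)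
  moreover have "\<exists>y. y \<in> S' \<and> y \<noteq> x \<and> y \<noteq> z"
  proof (rule ccontr)
    assume "\<not> ?thesis"
    then have "S' \<subseteq> {x, z}" by auto
    then have "card S' \<le> card {x, z}" by (intro card_mono) auto
    also have "\<dots> \<le> 2" by (simp add: card_insert_if)
    finally show False using S' by simp
  qed
  then obtain y where y: "y \<in> S'" "y \<noteq> x" "y \<noteq> z" by blast
  have "x \<le> y" "y \<le> z" using S' y by (auto simp: x_def z_def)
  ultimately have xyz: "x < y" "y < z" "F x = 0" "F y = 0" "F z = 0"
    using y S' assms(5) by (auto simp: F_def less_le)
  \<comment> \<open>Three zeros of F give two of F' and one of F'', but F'' is a positive
    exponential minus 2 r with r < 0.\<close>
  obtain s where s: "s < y" "F' s = 0" using Rolle_zero[OF D(1) xyz(1)] xyz by auto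
  obtain t where t: "y < t" "F' t = 0" using Rolle_zero[OF D(1) xyz(2)] xyz by auto
  obtain w where "F'' w = 0" using Rolle_zero[OF D(2), of s t] s t by auto
  moreover have "0 \<le> k / c\<^sup>2 * exp (- w / c)" using assms by simp
  ultimately show False using assms by (simp add: F''_def)
qed

text \<open>Removing the coordinate b = a_j applies 1 + bD to both sides. On the quadratic this
  changes p and q, hence their generalisation in the induction, but it preserves r, whose sign is
  what the base case relies on.\<close>

lemma mix_minus_quadratic_zeros:
  assumes cd: "0 < c" "d < 0" and r: "r < 0" and J: "finite J"
    and S: "finite S" "\<And>x. x \<in> S \<Longrightarrow> mix a J (two_sided c d) x = p + q * x + r * x\<^sup>2"
  shows "card S \<le> 4"
  using J S
proof (induction J arbitrary: p q S rule: finite_induct)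
  case empty
  have *: "two_sided c d x = p + q * x + r * x\<^sup>2" if "x \<in> S" for x
    using empty that by (simp add: mix_empty)
  have "card {x \<in> S. 0 \<le> x} \<le> 2"
  proof (rule exp_minus_quadratic_zeros[OF _ r])
    show "(1 / (c - d)) * exp (- x / c) = p + q * x + r * x\<^sup>2" if "x \<in> {x \<in> S. 0 \<le> x}" for x
    proof -
      have "x / d \<le> x / c" using that cd by (auto intro: order_trans[of _ 0] simp: divide_nonneg_neg)
      then have "max (x / c) (x / d) = x / c" by (rule max_absorb1)
      then show ?thesis using that *[of x] by (simp add: two_sided_def)
    qed
  qed (use cd empty in auto)
  moreover have "card {x \<in> S. x \<le> 0} \<le> 2"
  proof (rule exp_minus_quadratic_zeros[OF _ r])
    show "(1 / (c - d)) * exp (- x / d) = p + q * x + r * x\<^sup>2" if "x \<in> {x \<in> S. x \<le> 0}" for x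
    proof -
      have "x / c \<le> x / d" using that cd by (auto intro: order_trans[of _ 0] simp: divide_nonpos_pos divide_nonpos_neg)
      then have "max (x / c) (x / d) = x / d" by (rule max_absorb2)
      then show ?thesis using that *[of x] by (simp add: two_sided_def)
    qed
  qed (use cd empty in auto)
  \<comment> \<open>The point 0 may be counted in both halves, as only an upper bound is at
    stake.\<close>
  moreover have "card S \<le> card {x \<in> S. 0 \<le> x} + card {x \<in> S. x \<le> 0}"
    by (rule order_trans[OF card_mono card_Un_le]) (use empty in auto)
  ultimately show ?case by linarith
next
  case (insert j J)
  let ?g = "mix a J (two_sided c d)"
  have g: "quad_growth ?g" by (rule two_sided_mix[OF cd insert.hyps(1)])
  have eq: "mix a (insert j J) (two_sided c d) = smear (a j) ?g"
    by (rule two_sided_mix_insert[OF cd insert.hyps(1,2)])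
  show ?case
  proof (cases "a j = 0")
    case True
    show ?thesis by (rule insert.IH) (use insert.prems True in \<open>auto simp: eq smear_0\<close>)
  next
    case False
    let ?b = "a j"
    \<comment> \<open>The new coefficients are those of (1 + bD)(p + q x + r x^2).\<close>
    have "\<exists>T. finite T \<and> card T = card S \<and> T \<inter> S = {} \<and> (\<forall>t\<in>T. ?g t - ((p + ?b * q) + (q + 2 * ?b * r) * t + r * t\<^sup>2) = 0)"
    proof (rule zeros_first_order_operator)
      show "quad_growth (\<lambda>x. smear ?b ?g x - (p + q * x + r * x\<^sup>2))"
        by (intro quad_growth_diff quad_growth_smear g False quad_growth_quadratic)
      show "((\<lambda>x. smear ?b ?g x - (p + q * x + r * x\<^sup>2)) has_real_derivative
        (?g x - ((p + ?b * q) + (q + 2 * ?b * r) * x + r * x\<^sup>2) - (smear ?b ?g x - (p + q * x + r * x\<^sup>2))) / ?b) (at x)" for x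
        using False
        by (auto intro!: derivative_eq_intros smear_has_derivative g simp: field_simps power2_eq_square)
    qed (use insert.prems False in \<open>auto simp: eq\<close>)
    then obtain T where T: "finite T" "card T = card S"
      "\<And>t. t \<in> T \<Longrightarrow> ?g t = (p + ?b * q) + (q + 2 * ?b * r) * t + r * t\<^sup>2" by auto
    have "card T \<le> 4" using insert.IH[OF T(1,3)] .
    then show ?thesis using T by simp
  qed
qed

text \<open>By the resolvent identity the difference quotient of s T_s f(0) at c is exactly T_s (T_c
  f)(0), so only continuity in s of the smear of a bounded continuous function is left to show. The
  factor s is what makes the quotient exact.\<close>

lemma times_smear_has_derivative:
  assumes f: "quad_growth f" "\<And>x. \<bar>f x\<bar> \<le> C" and c: "c \<noteq> 0"
  shows "((\<lambda>s. s * smear s f 0) has_real_derivative smear c (smear c f) 0) (at c)"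
proof -
  note [measurable] = quad_growth_measurable[OF f(1)]
  let ?p = "smear c f"
  have p: "quad_growth ?p" by (rule quad_growth_smear[OF f(1) c])
  have pc: "isCont ?p x" for x using p by (simp add: quad_growth_def continuous_on_eq_continuous_at)
  note [measurable] = quad_growth_measurable[OF p]
  have pb: "\<bar>?p x\<bar> \<le> C" for x by (rule smear_bounded[OF f(2)]) measurable
  have "isCont (\<lambda>s. smear s ?p 0) c"
  proof (subst continuous_at_sequentially, intro allI impI)
    fix u :: "nat \<Rightarrow> real" assume u: "u \<longlonglongrightarrow> c"
    have "(\<lambda>n. smear (u n) ?p 0) \<longlonglongrightarrow> smear c ?p 0"
      unfolding smear_def[of _ ?p]
      by (intro integral_dominated_convergence[where w = "\<lambda>_. C"])
         (use pb in \<open>auto intro!: isCont_tendsto_compose[OF pc] tendsto_intros u\<close>)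
    then show "((\<lambda>s. smear s ?p 0) \<circ> u) \<longlonglongrightarrow> smear c ?p 0" by (simp add: o_def)
  qed
  then have lim: "((\<lambda>s. smear s ?p 0) \<longlongrightarrow> smear c ?p 0) (at c)" by (simp add: isCont_def)
  have "\<forall>\<^sub>F s in at c. smear s ?p 0 = (s * smear s f 0 - c * smear c f 0) / (s - c)"
  proof -
    have "\<forall>\<^sub>F s in at c. s \<noteq> 0" using c by (intro eventually_neq_at_within)
    moreover have "\<forall>\<^sub>F s in at c. s \<noteq> c" by (rule eventually_neq_at_within)
    ultimately show ?thesis
      by eventually_elim (use smear_resolvent[OF f(1) _ c, of _ 0] in \<open>auto simp: field_simps\<close>)
  qed
  then show ?thesis
    unfolding has_field_derivative_iff by (rule Lim_transform_eventually[OF lim])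
qed

section \<open>Directional derivatives of the density\<close>

text \<open>Tailored to a kernel with a kink: the pointwise derivative is asked for almost
  everywhere, and only increments from t = 0 are dominated.\<close>

lemma integral_has_derivative_at_0:
  fixes G :: "real \<Rightarrow> 'a \<Rightarrow> real"
  assumes e: "0 < e" and int: "\<And>t. \<bar>t\<bar> \<le> e \<Longrightarrow> integrable M (G t)"
    and D: "AE y in M. ((\<lambda>t. G t y) has_real_derivative G' y) (at 0)"
    and G'[measurable]: "G' \<in> borel_measurable M"
    and W: "integrable M W" "\<And>t y. \<bar>t\<bar> \<le> e \<Longrightarrow> \<bar>G t y - G 0 y\<bar> \<le> \<bar>t\<bar> * W y"
  shows "((\<lambda>t. \<integral>y. G t y \<partial>M) has_real_derivative (\<integral>y. G' y \<partial>M)) (at 0)"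
  unfolding has_field_derivative_iff tendsto_at_iff_sequentially
proof (intro allI impI)
  fix u :: "nat \<Rightarrow> real"
  assume u0: "\<forall>i. u i \<in> UNIV - {0}" and u: "u \<longlonglongrightarrow> 0"
  then have "eventually (\<lambda>n. \<bar>u n\<bar> < e) sequentially"
    using e by (auto simp: tendsto_iff dist_real_def)
  then obtain N where N: "\<And>n. n \<ge> N \<Longrightarrow> \<bar>u n\<bar> < e" by (auto simp: eventually_sequentially)
  define v where "v = (\<lambda>n. u (n + N))"
  have v: "v \<longlonglongrightarrow> 0" "\<And>n. v n \<noteq> 0" "\<And>n. \<bar>v n\<bar> \<le> e"
    using LIMSEQ_ignore_initial_segment[OF u, of N] u0 N by (auto simp: v_def less_imp_le)
  have intv: "integrable M (G (v n))" "integrable M (G 0)" for n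
    using int v(3) e by auto
  have "(\<lambda>n. \<integral>y. (G (v n) y - G 0 y) / v n \<partial>M) \<longlonglongrightarrow> (\<integral>y. G' y \<partial>M)"
  proof (rule integral_dominated_convergence[where w = W])
    show "AE y in M. (\<lambda>n. (G (v n) y - G 0 y) / v n) \<longlonglongrightarrow> G' y"
      using D
    proof eventually_elim
      case (elim y)
      then have "\<And>X. (\<forall>i. X i \<in> UNIV - {0}) \<Longrightarrow> X \<longlonglongrightarrow> 0 \<Longrightarrow>
          ((\<lambda>t. (G t y - G 0 y) / (t - 0)) \<circ> X) \<longlonglongrightarrow> G' y"
        unfolding has_field_derivative_iff tendsto_at_iff_sequentially by blast
      from this[of v] show ?case using v by (simp add: o_def)
    qed
    show "AE y in M. norm ((G (v n) y - G 0 y) / v n) \<le> W y" for n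
    proof (rule AE_I2)
      fix y
      show "norm ((G (v n) y - G 0 y) / v n) \<le> W y"
        using W(2)[OF v(3)[of n], of y] v(2)[of n] by (simp add: field_simps)
    qed
    show "(\<lambda>y. (G (v n) y - G 0 y) / v n) \<in> borel_measurable M" for n
      using intv(1)[of n] intv(2) by measurable
  qed (use W in auto)
  moreover have "(\<integral>y. (G (v n) y - G 0 y) / v n \<partial>M) = ((\<integral>y. G (v n) y \<partial>M) - (\<integral>y. G 0 y \<partial>M)) / v n" for n
    using intv(1)[of n] intv(2) v(2)[of n] by simp
  ultimately have "(\<lambda>n. ((\<integral>y. G (u (n + N)) y \<partial>M) - (\<integral>y. G 0 y \<partial>M)) / u (n + N)) \<longlonglongrightarrow> (\<integral>y. G' y \<partial>M)"
    by (simp only: v_def)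
  then have "(\<lambda>n. ((\<integral>y. G (u n) y \<partial>M) - (\<integral>y. G 0 y \<partial>M)) / u n) \<longlonglongrightarrow> (\<integral>y. G' y \<partial>M)"
    by (rule LIMSEQ_offset)
  then show "((\<lambda>t. ((\<integral>y. G t y \<partial>M) - (\<integral>y. G 0 y \<partial>M)) / (t - 0)) \<circ> u) \<longlonglongrightarrow> (\<integral>y. G' y \<partial>M)"
    by (simp add: o_def)
qed

lemma exp_minus_lipschitz:
  fixes u v :: real
  assumes "0 \<le> u" "0 \<le> v"
  shows "\<bar>exp (- u) - exp (- v)\<bar> \<le> \<bar>u - v\<bar>"
proof -
  have *: "exp (- u) - exp (- v) \<le> v - u" if "0 \<le> u" "u \<le> v" for u v :: real
  proof -
    have "exp (- u) - exp (- v) = exp (- u) * (1 - exp (u - v))"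
      by (simp add: algebra_simps exp_add[symmetric])
    also have "\<dots> \<le> 1 * (v - u)"
    proof (intro mult_mono)
      show "1 - exp (u - v) \<le> v - u" using exp_ge_add_one_self[of "u - v"] by linarith
    qed (use that in auto)
    finally show ?thesis by simp
  qed
  show ?thesis
    using *[of u v] *[of v u] assms by (cases "u \<le> v") (auto simp: abs_if)
qed

text \<open>As long as t p is at most half of c in absolute value, the new denominator keeps at
  least half its size; this is the factor 2.\<close>

lemma quotient_perturbation:
  fixes c p t x z :: real
  assumes "c \<noteq> 0" "\<bar>t\<bar> * \<bar>p\<bar> \<le> \<bar>c\<bar> / 2"
  shows "\<bar>(x + t * z) / (c + t * p) - x / c\<bar> \<le> \<bar>t\<bar> * (2 * (\<bar>c\<bar> * \<bar>z\<bar> + \<bar>p\<bar> * \<bar>x\<bar>) / c\<^sup>2)"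
proof -
  have "\<bar>c\<bar> / 2 \<le> \<bar>c\<bar> - \<bar>t * p\<bar>" using assms by (simp add: abs_mult)
  also have "\<dots> \<le> \<bar>c + t * p\<bar>" by linarith
  finally have b: "\<bar>c\<bar> / 2 \<le> \<bar>c + t * p\<bar>" .
  then have nz: "c + t * p \<noteq> 0" using assms(1) by auto
  have "(x + t * z) / (c + t * p) - x / c = t * (c * z - p * x) / (c * (c + t * p))"
    using assms(1) nz by (simp add: field_simps)
  then have "\<bar>(x + t * z) / (c + t * p) - x / c\<bar> = \<bar>t\<bar> * (\<bar>c * z - p * x\<bar> / (\<bar>c\<bar> * \<bar>c + t * p\<bar>))"
    by (simp add: abs_mult)
  also have "\<dots> \<le> \<bar>t\<bar> * ((\<bar>c\<bar> * \<bar>z\<bar> + \<bar>p\<bar> * \<bar>x\<bar>) / (\<bar>c\<bar> * (\<bar>c\<bar> / 2)))"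
  proof (rule mult_left_mono, rule frac_le)
    show "\<bar>c * z - p * x\<bar> \<le> \<bar>c\<bar> * \<bar>z\<bar> + \<bar>p\<bar> * \<bar>x\<bar>"
      using abs_triangle_ineq4[of "c * z" "p * x"] by (simp add: abs_mult)
    show "0 < \<bar>c\<bar> * (\<bar>c\<bar> / 2)" using assms(1) by (intro mult_pos_pos) auto
    show "\<bar>c\<bar> * (\<bar>c\<bar> / 2) \<le> \<bar>c\<bar> * \<bar>c + t * p\<bar>" using b by (intro mult_left_mono) auto
  qed auto
  also have "(\<bar>c\<bar> * \<bar>z\<bar> + \<bar>p\<bar> * \<bar>x\<bar>) / (\<bar>c\<bar> * (\<bar>c\<bar> / 2)) = 2 * (\<bar>c\<bar> * \<bar>z\<bar> + \<bar>p\<bar> * \<bar>x\<bar>) / c\<^sup>2"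
    by (simp add: power2_eq_square)
  finally show ?thesis .
qed

text \<open>A Lipschitz constant along the line (c + t p, d + t q, x + t z). The first summand is
  the change of the two exponents times a bound 2 / (c - d) for the perturbed normalising factor,
  the second the change of that factor. It grows linearly in |x| and |z|, so first moments make it
  integrable.\<close>

definition two_sided_modulus :: "real \<Rightarrow> real \<Rightarrow> real \<Rightarrow> real \<Rightarrow> real \<Rightarrow> real \<Rightarrow> real" where
  "two_sided_modulus c d p q x z =
     (2 * (\<bar>c\<bar> * \<bar>z\<bar> + \<bar>p\<bar> * \<bar>x\<bar>) / c\<^sup>2 + 2 * (\<bar>d\<bar> * \<bar>z\<bar> + \<bar>q\<bar> * \<bar>x\<bar>) / d\<^sup>2) * (2 / (c - d))
       + 2 * \<bar>p - q\<bar> / (c - d)\<^sup>2"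

lemma two_sided_perturbation:
  assumes c: "0 < c" "\<bar>t\<bar> * \<bar>p\<bar> \<le> c / 2" and d: "d < 0" "\<bar>t\<bar> * \<bar>q\<bar> \<le> - d / 2"
  shows "\<bar>two_sided (c + t * p) (d + t * q) (x + t * z) - two_sided c d x\<bar> \<le> \<bar>t\<bar> * two_sided_modulus c d p q x z"
proof -
  have "\<bar>t * p\<bar> \<le> c / 2" "\<bar>t * q\<bar> \<le> - d / 2" using c d by (simp_all add: abs_mult)
  then have ct: "c / 2 \<le> c + t * p" and dt: "d + t * q \<le> d / 2" by linarith+
  define M where "M = max ((x + t * z) / (c + t * p)) ((x + t * z) / (d + t * q))"
  define M0 where "M0 = max (x / c) (x / d)"
  define R where "R = 1 / ((c + t * p) - (d + t * q))"
  define R0 where "R0 = 1 / (c - d)"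
  have M: "0 \<le> M" "0 \<le> M0" unfolding M_def M0_def using c d ct dt by (auto intro!: max_div_nonneg)
  define A where "A = 2 * (\<bar>c\<bar> * \<bar>z\<bar> + \<bar>p\<bar> * \<bar>x\<bar>) / c\<^sup>2"
  define B where "B = 2 * (\<bar>d\<bar> * \<bar>z\<bar> + \<bar>q\<bar> * \<bar>x\<bar>) / d\<^sup>2"
  have AB: "0 \<le> A" "0 \<le> B" by (auto simp: A_def B_def)
  have 1: "\<bar>(x + t * z) / (c + t * p) - x / c\<bar> \<le> \<bar>t\<bar> * A"
    unfolding A_def using c by (intro quotient_perturbation) auto
  have 2: "\<bar>(x + t * z) / (d + t * q) - x / d\<bar> \<le> \<bar>t\<bar> * B"
    unfolding B_def using d by (intro quotient_perturbation) auto
  have "0 \<le> \<bar>t\<bar> * A" "0 \<le> \<bar>t\<bar> * B" using AB by auto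
  then have MM: "\<bar>M - M0\<bar> \<le> \<bar>t\<bar> * A + \<bar>t\<bar> * B"
    using 1 2 unfolding M_def M0_def by (auto simp: max_def abs_if split: if_splits)
  have 3: "\<bar>exp (- M) - exp (- M0)\<bar> \<le> \<bar>t\<bar> * A + \<bar>t\<bar> * B"
    using exp_minus_lipschitz[OF M] MM by linarith
  have R: "0 \<le> R" "R \<le> 2 / (c - d)"
  proof -
    have "0 < c - d" "(c - d) / 2 \<le> (c + t * p) - (d + t * q)" using c d ct dt by auto
    then have "1 / ((c + t * p) - (d + t * q)) \<le> 1 / ((c - d) / 2)" by (intro frac_le) auto
    then show "R \<le> 2 / (c - d)" by (simp add: R_def)
    show "0 \<le> R" unfolding R_def using c d ct dt by auto
  qed
  have 4: "\<bar>R - R0\<bar> \<le> \<bar>t\<bar> * (2 * \<bar>p - q\<bar> / (c - d)\<^sup>2)"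
  proof -
    have "\<bar>t\<bar> * \<bar>p - q\<bar> \<le> \<bar>t\<bar> * (\<bar>p\<bar> + \<bar>q\<bar>)" by (intro mult_left_mono) auto
    also have "\<dots> \<le> \<bar>c - d\<bar> / 2" using c d by (simp add: distrib_left)
    finally have "\<bar>t\<bar> * \<bar>p - q\<bar> \<le> \<bar>c - d\<bar> / 2" .
    from quotient_perturbation[OF _ this, of 1 0] show ?thesis
      using c d by (simp add: R_def R0_def algebra_simps)
  qed
  have e0: "0 \<le> exp (- M0)" "exp (- M0) \<le> 1" using M by auto
  have "\<bar>exp (- M) * R - exp (- M0) * R0\<bar> = \<bar>(exp (- M) - exp (- M0)) * R + exp (- M0) * (R - R0)\<bar>"
    by (simp add: algebra_simps)
  also have "\<dots> \<le> \<bar>exp (- M) - exp (- M0)\<bar> * R + exp (- M0) * \<bar>R - R0\<bar>"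
    using R e0 abs_triangle_ineq[of "(exp (- M) - exp (- M0)) * R" "exp (- M0) * (R - R0)"] by (simp add: abs_mult)
  also have "\<dots> \<le> (\<bar>t\<bar> * A + \<bar>t\<bar> * B) * (2 / (c - d)) + 1 * (\<bar>t\<bar> * (2 * \<bar>p - q\<bar> / (c - d)\<^sup>2))"
    using 3 4 R e0 AB by (intro add_mono mult_mono) auto
  also have "\<dots> = \<bar>t\<bar> * two_sided_modulus c d p q x z"
    unfolding two_sided_modulus_def A_def[symmetric] B_def[symmetric] by (simp add: algebra_simps add_divide_distrib)
  finally show ?thesis
    by (simp add: two_sided_def M_def M0_def R_def R0_def)
qed

text \<open>The derivative is displayed as a linear form in the direction (p, q, z) whose
  coefficients, the partial derivatives, depend on c, d, x alone. The point x = 0 is the kink of the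
  maximum.\<close>

lemma two_sided_curve_derivative:
  assumes c: "0 < c" and d: "d < 0" and x: "x \<noteq> 0"
  shows "((\<lambda>t. two_sided (c + t * p) (d + t * q) (x + t * z)) has_real_derivative
    p * (two_sided c d x * ((if 0 < x then x / c\<^sup>2 else 0) - 1 / (c - d)))
    + q * (two_sided c d x * ((if 0 < x then 0 else x / d\<^sup>2) + 1 / (c - d)))
    - z * (two_sided c d x * (if 0 < x then 1 / c else 1 / d))) (at 0)"
proof -
  have "open {t. 0 < c + t * p \<and> d + t * q < 0}"
    by (intro open_Collect_conj open_Collect_less continuous_intros)
  then have ev1: "eventually (\<lambda>t. t \<in> {t. 0 < c + t * p \<and> d + t * q < 0}) (nhds 0)"
    using c d by (intro eventually_nhds_in_open) auto
  have D2: "((\<lambda>t. (c + t * p) - (d + t * q)) has_real_derivative p - q) (at 0)"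
    by (auto intro!: derivative_eq_intros)
  \<comment> \<open>The outcome of the quotient rule, with E the exponential and K = c - d,
    rearranged into the linear form on either side of the kink.\<close>
  have curve_eq: "(E * - ((z * c - x * p) / c\<^sup>2) * K - E * (p - q)) / (K * K) =
      p * (E / K * (x / c\<^sup>2 - 1 / K)) + q * (E / K * (0 + 1 / K)) - z * (E / K * (1 / c))"
      "(E * - ((z * d - x * q) / d\<^sup>2) * K - E * (p - q)) / (K * K) =
      p * (E / K * (0 - 1 / K)) + q * (E / K * (x / d\<^sup>2 + 1 / K)) - z * (E / K * (1 / d))"
    if "K \<noteq> 0" for K E :: real
    using that c d by (simp_all add: field_simps power2_eq_square)
  have K: "c - d \<noteq> 0" using c d by simp
  show ?thesis
  proof (cases "0 < x")
    case True
    have "open {t. 0 < x + t * z}" by (intro open_Collect_less continuous_intros)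
    then have ev2: "eventually (\<lambda>t. t \<in> {t. 0 < x + t * z}) (nhds 0)"
      using True by (intro eventually_nhds_in_open) auto
    have m: "max (y / c) (y / d) = y / c" if "0 < y" "0 < c" "d < 0" for y c d :: real
      using that by (intro max_absorb1) (meson divide_pos_neg divide_pos_pos less_imp_le order.trans)
    have ev: "eventually (\<lambda>t. two_sided (c + t * p) (d + t * q) (x + t * z) =
        exp (- ((x + t * z) / (c + t * p))) / ((c + t * p) - (d + t * q))) (nhds 0)"
      using ev1 ev2 by eventually_elim (simp add: two_sided_def m)
    have v: "two_sided c d x = exp (- (x / c)) / (c - d)"
      using m[OF True c d] by (simp add: two_sided_def)
    have "((\<lambda>t. - ((x + t * z) / (c + t * p))) has_real_derivative - ((z * c - x * p) / c\<^sup>2)) (at 0)"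
      using c d by (auto intro!: derivative_eq_intros simp: power2_eq_square)
    from DERIV_divide[OF DERIV_fun_exp[OF this] D2] K
    have "((\<lambda>t. exp (- ((x + t * z) / (c + t * p))) / ((c + t * p) - (d + t * q))) has_real_derivative
       (exp (- (x / c)) * - ((z * c - x * p) / c\<^sup>2) * (c - d) - exp (- (x / c)) * (p - q)) / ((c - d) * (c - d))) (at 0)"
      by (simp only: mult_zero_left add_0_right diff_0_right not_False_eq_True simp_thms)
    then show ?thesis
      unfolding DERIV_cong_ev[OF refl ev refl] v curve_eq(1)[OF K] using True by (simp only: if_True)
  next
    case False
    then have neg: "x < 0" using x by simp
    have "open {t. x + t * z < 0}" by (intro open_Collect_less continuous_intros)
    then have ev2: "eventually (\<lambda>t. t \<in> {t. x + t * z < 0}) (nhds 0)"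
      using neg by (intro eventually_nhds_in_open) auto
    have m: "max (y / c) (y / d) = y / d" if "y < 0" "0 < c" "d < 0" for y c d :: real
      using that by (intro max_absorb2) (meson divide_neg_neg divide_neg_pos less_imp_le order.trans)
    have ev: "eventually (\<lambda>t. two_sided (c + t * p) (d + t * q) (x + t * z) =
        exp (- ((x + t * z) / (d + t * q))) / ((c + t * p) - (d + t * q))) (nhds 0)"
      using ev1 ev2 by eventually_elim (simp add: two_sided_def m)
    have v: "two_sided c d x = exp (- (x / d)) / (c - d)"
      using m[OF neg c d] by (simp add: two_sided_def)
    have "((\<lambda>t. - ((x + t * z) / (d + t * q))) has_real_derivative - ((z * d - x * q) / d\<^sup>2)) (at 0)"
      using c d by (auto intro!: derivative_eq_intros simp: power2_eq_square)
    from DERIV_divide[OF DERIV_fun_exp[OF this] D2] K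
    have "((\<lambda>t. exp (- ((x + t * z) / (d + t * q))) / ((c + t * p) - (d + t * q))) has_real_derivative
       (exp (- (x / d)) * - ((z * d - x * q) / d\<^sup>2) * (c - d) - exp (- (x / d)) * (p - q)) / ((c - d) * (c - d))) (at 0)"
      by (simp only: mult_zero_left add_0_right diff_0_right not_False_eq_True simp_thms)
    then show ?thesis
      unfolding DERIV_cong_ev[OF refl ev refl] v curve_eq(2)[OF K] using False by (simp only: if_False)
  qed
qed

lemma integrable_PiM_exp_component: "j \<in> J \<Longrightarrow> integrable (\<Pi>\<^sub>M j\<in>J. exp_measure) (\<lambda>y. y j)"
proof -
  assume j: "j \<in> J"
  have "integrable (distr (\<Pi>\<^sub>M j\<in>J. exp_measure) exp_measure (\<lambda>y. y j)) (\<lambda>x. x)"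
    using integrable_exp_measure_power[of 1]
    by (subst distr_PiM_component[OF _ j]) (auto intro: prob_space_exp_measure)
  then show ?thesis
    by (subst (asm) integrable_distr_eq) (use j in auto)
qed

lemma two_sided_measurable [measurable]: "two_sided c d \<in> borel_measurable borel"
  unfolding two_sided_def by measurable

text \<open>The coefficients A, B, D are chosen before the direction. This linearity in the
  direction is what the Lagrange argument uses; it is obtained by integrating the linear form of the
  pointwise derivative.\<close>

lemma mix_directional_derivative:
  fixes a :: "'i \<Rightarrow> real"
  assumes c: "0 < c" and d: "d < 0" and J: "finite J" and nz: "\<exists>j\<in>J. a j \<noteq> 0"
  shows "\<exists>A B D. \<forall>p q h. ((\<lambda>t. mix (\<lambda>j. a j + t * h j) J (two_sided (c + t * p) (d + t * q)) 0)
    has_real_derivative p * A + q * B + (\<Sum>j\<in>J. h j * D j)) (at 0)"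
proof -
  let ?M = "\<Pi>\<^sub>M j\<in>J. exp_measure"
  interpret prob_space ?M by (rule prob_PiM_exp)
  define X where "X = (\<lambda>y. 0 - (\<Sum>j\<in>J. a j * y j))"
  define F where "F = (\<lambda>y. two_sided c d (X y))"
  have [measurable]: "X \<in> borel_measurable ?M" "F \<in> borel_measurable ?M"
    unfolding X_def F_def by measurable
  have F: "\<bar>F y\<bar> \<le> 1 / (c - d)" for y
    unfolding F_def using two_sided_bounds[OF c d, of "X y"] by auto
  have intX: "integrable ?M X"
    unfolding X_def
    by (intro Bochner_Integration.integrable_diff integrable_const Bochner_Integration.integrable_sum
        integrable_mult_right integrable_PiM_exp_component)
  have intF: "integrable ?M (\<lambda>y. F y * g y)" if g: "integrable ?M g" for g
  proof (rule Bochner_Integration.integrable_bound)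
    show "integrable ?M (\<lambda>y. (1 / (c - d)) * g y)" using g by simp
    show "AE y in ?M. norm (F y * g y) \<le> norm (1 / (c - d) * g y)"
    proof (rule AE_I2)
      fix y
      have "\<bar>F y\<bar> * \<bar>g y\<bar> \<le> 1 / (c - d) * \<bar>g y\<bar>" by (rule mult_right_mono[OF F]) simp
      then show "norm (F y * g y) \<le> norm (1 / (c - d) * g y)" using c d by (simp add: abs_mult)
    qed
  qed (use g in measurable)
  define gA where "gA = (\<lambda>y. (if 0 < X y then X y / c\<^sup>2 else 0) - 1 / (c - d))"
  define gB where "gB = (\<lambda>y. (if 0 < X y then 0 else X y / d\<^sup>2) + 1 / (c - d))"
  define gD where "gD = (\<lambda>j y. y j * (if 0 < X y then 1 / c else 1 / d))"
  have int: "integrable ?M gA" "integrable ?M gB" "\<And>j. j \<in> J \<Longrightarrow> integrable ?M (gD j)"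
  proof -
    have "integrable ?M (\<lambda>y. if 0 < X y then X y / c\<^sup>2 else 0)"
      by (rule Bochner_Integration.integrable_bound[of _ "\<lambda>y. X y / c\<^sup>2"])
         (use intX in \<open>auto intro!: AE_I2 simp del: abs_divide\<close>)
    then show "integrable ?M gA" unfolding gA_def by (intro Bochner_Integration.integrable_diff) auto
    have "integrable ?M (\<lambda>y. if 0 < X y then 0 else X y / d\<^sup>2)"
      by (rule Bochner_Integration.integrable_bound[of _ "\<lambda>y. X y / d\<^sup>2"])
         (use intX in \<open>auto intro!: AE_I2 simp del: abs_divide\<close>)
    then show "integrable ?M gB" unfolding gB_def by (intro Bochner_Integration.integrable_add) auto
    fix j assume j: "j \<in> J"
    show "integrable ?M (gD j)"
      unfolding gD_def
    proof (rule Bochner_Integration.integrable_bound)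
      show "integrable ?M (\<lambda>y. (\<bar>1 / c\<bar> + \<bar>1 / d\<bar>) * y j)"
        by (intro integrable_mult_right integrable_PiM_exp_component j)
      show "AE y in ?M. norm (y j * (if 0 < X y then 1 / c else 1 / d)) \<le> norm ((\<bar>1 / c\<bar> + \<bar>1 / d\<bar>) * y j)"
      proof (rule AE_I2)
        fix y
        have "\<bar>if 0 < X y then 1 / c else 1 / d\<bar> * \<bar>y j\<bar> \<le> (\<bar>1 / c\<bar> + \<bar>1 / d\<bar>) * \<bar>y j\<bar>"
          by (intro mult_right_mono) auto
        then show "norm (y j * (if 0 < X y then 1 / c else 1 / d)) \<le> norm ((\<bar>1 / c\<bar> + \<bar>1 / d\<bar>) * y j)"
          by (simp only: real_norm_def abs_mult mult.commute[of "\<bar>y j\<bar>"]) simp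
      qed
    qed (use j in measurable)
  qed
  have "((\<lambda>t. mix (\<lambda>j. a j + t * h j) J (two_sided (c + t * p) (d + t * q)) 0) has_real_derivative
      p * (\<integral>y. F y * gA y \<partial>?M) + q * (\<integral>y. F y * gB y \<partial>?M)
        + (\<Sum>j\<in>J. h j * (\<integral>y. F y * gD j y \<partial>?M))) (at 0)" for p q h
  proof -
    define Z where "Z = (\<lambda>y. 0 - (\<Sum>j\<in>J. h j * y j))"
    have intZ: "integrable ?M Z"
      unfolding Z_def
      by (intro Bochner_Integration.integrable_diff integrable_const Bochner_Integration.integrable_sum
          integrable_mult_right integrable_PiM_exp_component)
    have [measurable]: "Z \<in> borel_measurable ?M" unfolding Z_def by measurable
    define G where "G = (\<lambda>t y. two_sided (c + t * p) (d + t * q) (X y + t * Z y))"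
    have G: "mix (\<lambda>j. a j + t * h j) J (two_sided (c + t * p) (d + t * q)) 0 = (\<integral>y. G t y \<partial>?M)" for t
      unfolding mix_def G_def X_def Z_def
      by (simp add: algebra_simps sum.distrib sum_distrib_left)
    \<comment> \<open>For |t| up to e the perturbed c and d keep at least half their size, hence
      their signs; the added 1 avoids division by 0.\<close>
    define e where "e = min (c / 2 / (\<bar>p\<bar> + 1)) (- d / 2 / (\<bar>q\<bar> + 1))"
    have e: "0 < e" unfolding e_def using c d by (auto simp: divide_neg_pos)
    have te: "\<bar>t\<bar> * \<bar>p\<bar> \<le> c / 2" "\<bar>t\<bar> * \<bar>q\<bar> \<le> - d / 2" if "\<bar>t\<bar> \<le> e" for t
    proof -
      have "\<bar>t\<bar> \<le> c / 2 / (\<bar>p\<bar> + 1)" "\<bar>t\<bar> \<le> - d / 2 / (\<bar>q\<bar> + 1)" using that by (auto simp: e_def)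
      then have "\<bar>t\<bar> * (\<bar>p\<bar> + 1) \<le> c / 2" "\<bar>t\<bar> * (\<bar>q\<bar> + 1) \<le> - d / 2"
        using pos_le_divide_eq[of "\<bar>p\<bar> + 1" "\<bar>t\<bar>" "c / 2"] pos_le_divide_eq[of "\<bar>q\<bar> + 1" "\<bar>t\<bar>" "- d / 2"]
        by linarith+
      then show "\<bar>t\<bar> * \<bar>p\<bar> \<le> c / 2" "\<bar>t\<bar> * \<bar>q\<bar> \<le> - d / 2"
        by (simp_all add: distrib_left)
    qed
    define G' where "G' = (\<lambda>y. p * (F y * gA y) + q * (F y * gB y) - Z y * (F y * (if 0 < X y then 1 / c else 1 / d)))"
    have [measurable]: "gA \<in> borel_measurable ?M" "gB \<in> borel_measurable ?M"
      using int by auto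
    have "((\<lambda>t. \<integral>y. G t y \<partial>?M) has_real_derivative (\<integral>y. G' y \<partial>?M)) (at 0)"
    proof (rule integral_has_derivative_at_0[OF e, where W = "\<lambda>y. two_sided_modulus c d p q (X y) (Z y)"])
      show "integrable ?M (G t)" if "\<bar>t\<bar> \<le> e" for t
      proof (rule integrable_bounded_prob[OF prob_space_axioms])
        show "G t \<in> borel_measurable ?M" unfolding G_def by measurable
        have "\<bar>t * p\<bar> \<le> c / 2" "\<bar>t * q\<bar> \<le> - d / 2" using te[OF that] by (simp_all add: abs_mult)
        then have "0 < c + t * p" "d + t * q < 0" using c d by linarith+
        from two_sided_bounds[OF this] show "\<bar>G t y\<bar> \<le> 1 / ((c + t * p) - (d + t * q))" for y
          unfolding G_def by (simp add: abs_of_pos)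
      qed
      have "AE y in ?M. X y \<noteq> 0"
        unfolding X_def using nz AE_sum_exp_neq[OF J, of _ a 0] by blast
      then show "AE y in ?M. ((\<lambda>t. G t y) has_real_derivative G' y) (at 0)"
        by eventually_elim (use two_sided_curve_derivative[OF c d] in \<open>simp add: G_def G'_def F_def gA_def gB_def\<close>)
      show "G' \<in> borel_measurable ?M" unfolding G'_def by measurable
      show "integrable ?M (\<lambda>y. two_sided_modulus c d p q (X y) (Z y))"
        unfolding two_sided_modulus_def
        by (intro Bochner_Integration.integrable_add integrable_mult_left integrable_divide
            integrable_mult_right integrable_const integrable_abs intX intZ)
      show "\<bar>G t y - G 0 y\<bar> \<le> \<bar>t\<bar> * two_sided_modulus c d p q (X y) (Z y)" if "\<bar>t\<bar> \<le> e" for t y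
        using two_sided_perturbation[OF c te(1)[OF that] d te(2)[OF that]] by (simp add: G_def)
    qed
    moreover have "(\<integral>y. G' y \<partial>?M) = p * (\<integral>y. F y * gA y \<partial>?M) + q * (\<integral>y. F y * gB y \<partial>?M)
        + (\<Sum>j\<in>J. h j * (\<integral>y. F y * gD j y \<partial>?M))"
    proof -
      have eq: "G' y = p * (F y * gA y) + q * (F y * gB y) + (\<Sum>j\<in>J. h j * (F y * gD j y))" for y
      proof -
        have "(\<Sum>j\<in>J. h j * (F y * gD j y)) = (\<Sum>j\<in>J. h j * y j) * (F y * (if 0 < X y then 1 / c else 1 / d))"
          unfolding gD_def sum_distrib_right by (intro sum.cong) (auto simp: mult_ac)
        then show ?thesis by (simp add: G'_def Z_def)
      qed
      have i: "integrable ?M (\<lambda>y. F y * gA y)" "integrable ?M (\<lambda>y. F y * gB y)"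
        "\<And>j. j \<in> J \<Longrightarrow> integrable ?M (\<lambda>y. F y * gD j y)"
        using int by (auto intro: intF)
      show ?thesis
        unfolding eq using i
        by (subst Bochner_Integration.integral_add)
           (auto simp: Bochner_Integration.integral_sum)
    qed
    ultimately show ?thesis by (simp add: G)
  qed
  then show ?thesis
    by (intro exI[of _ "\<integral>y. F y * gA y \<partial>?M"] exI[of _ "\<integral>y. F y * gB y \<partial>?M"]
        exI[of _ "\<lambda>j. \<integral>y. F y * gD j y \<partial>?M"] allI)
qed

section \<open>Critical points of the density\<close>

text \<open>The density at 0 of the sum of all a_j X_j, provided that a_k > 0 > a_l: these two are
  integrated out explicitly. The indices stay fixed while a varies, and the formula is meaningful
  even if every other coordinate is 0.\<close>

definition central_density :: "'i::finite \<Rightarrow> 'i \<Rightarrow> ('i \<Rightarrow> real) \<Rightarrow> real" where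
  "central_density k l a = mix a (- {k, l}) (two_sided (a k) (a l)) 0"

lemma two_sided_abs_le: "0 < c \<Longrightarrow> d < 0 \<Longrightarrow> \<bar>two_sided c d x\<bar> \<le> 1 / (c - d)"
  using two_sided_bounds[of c d x] by auto

lemma one_sided_abs_le: "\<bar>one_sided c x\<bar> \<le> 1 / \<bar>c\<bar>"
  using one_sided_bounds[of c x] by auto

text \<open>The index k outside J is a dummy that carries the parameter s; inserting it first or
  last gives the two sides.\<close>

lemma mix_smear_one_sided:
  assumes "finite J" "(k :: 'i) \<notin> J"
  shows "mix a J (smear s (one_sided c)) = smear s (mix a J (one_sided c))"
proof -
  have *: "mix (a(k := s)) J g = mix a J g" for g
    by (rule mix_cong) (use assms(2) in auto)
  note insert = mix_insert_inner[OF assms, where f = "one_sided c" and a = "a(k := s)", OF _ one_sided_abs_le]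
    mix_insert_outer[OF assms, where f = "one_sided c" and a = "a(k := s)", OF _ one_sided_abs_le]
  show ?thesis using insert by (simp add: *)
qed

text \<open>As a function of one nonzero coordinate, the density is an exponential smear of the
  density of the remaining coordinates, which is continuous.\<close>
lemma central_density_coordinate:
  fixes a :: "'i::finite \<Rightarrow> real"
  assumes k: "0 < a k" and l: "a l < 0" and i: "i \<notin> {k, l}" "a i \<noteq> 0" and j: "a j \<noteq> 0"
  shows "((\<lambda>s. s * central_density k l (a(j := s))) has_real_derivative
     smear (a j) (mix a (- {k, l}) (two_sided (a k) (a l))) 0) (at (a j))"
proof -
  let ?J = "- {k, l}" and ?p = "mix a (- {k, l}) (two_sided (a k) (a l))"
  have kl: "k \<noteq> l" using k l by auto
  have J: "finite ?J" "k \<notin> ?J" "l \<notin> ?J" "i \<in> ?J" using i by auto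
  \<comment> \<open>Here \<phi> is the density of the sum without coordinate j. If j is k or l, the
    two-sided kernel falls back to the one-sided kernel of the other index.\<close>
  obtain \<phi> C where \<phi>: "quad_growth \<phi>" "\<And>x. \<bar>\<phi> x\<bar> \<le> C" "smear (a j) \<phi> = ?p"
    and ev: "\<forall>\<^sub>F s in nhds (a j). central_density k l (a(j := s)) = smear s \<phi> 0"
  proof (cases "j \<in> {k, l}")
    case False
    define K where "K = - {j, k, l}"
    have JK: "?J = insert j K" "j \<notin> K" "finite K" using False by (auto simp: K_def)
    show ?thesis
    proof
      show "quad_growth (mix a K (two_sided (a k) (a l)))"
        "\<bar>mix a K (two_sided (a k) (a l)) x\<bar> \<le> 1 / (a k - a l)" for x
        by (rule two_sided_mix[OF k l JK(3)])+
      show "smear (a j) (mix a K (two_sided (a k) (a l))) = ?p"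
        unfolding JK(1) by (rule two_sided_mix_insert[OF k l JK(3,2), symmetric])
      have "central_density k l (a(j := s)) = smear s (mix a K (two_sided (a k) (a l))) 0" for s
      proof -
        have "mix (a(j := s)) K g = mix a K g" for g
          by (rule mix_cong) (use JK(2) in auto)
        then show ?thesis
          using False two_sided_mix_insert[OF k l JK(3,2), of "a(j := s)"]
          unfolding central_density_def JK(1) by (auto simp: fun_upd_other)
      qed
      then show "\<forall>\<^sub>F s in nhds (a j). central_density k l (a(j := s)) = smear s (mix a K (two_sided (a k) (a l))) 0"
        by simp
    qed
  next
    case True
    have cong: "mix (a(j := s)) ?J g = mix a ?J g" for s g
      by (rule mix_cong) (use True in auto)
    show ?thesis
    proof (cases "j = k")
      case True
      show ?thesis
      proof
        \<comment> \<open>The remaining kernel jumps at 0; averaging over the nonzero coordinate i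
          makes the mixture continuous.\<close>
        show "quad_growth (mix a ?J (one_sided (a l)))"
          using l J i by (intro mix_quad_growth[OF _ one_sided_abs_le] isCont_one_sided) auto
        show "\<bar>mix a ?J (one_sided (a l)) x\<bar> \<le> 1 / \<bar>a l\<bar>" for x
          by (rule mix_bounded[OF one_sided_abs_le]) simp
        show "smear (a j) (mix a ?J (one_sided (a l))) = ?p"
          using mix_smear_one_sided[OF J(1,2), of a "a j" "a l"] True
          by (simp add: smear_one_sided' k l)
        \<comment> \<open>\<open>two_sided\<close> represents the smear only while its first
          parameter is positive, so the identity holds only for s near a_k.\<close>
        have "open {0 :: real<..}" by simp
        then have "\<forall>\<^sub>F s in nhds (a j). s \<in> {0<..}"
          using True k by (intro eventually_nhds_in_open) auto
        then show "\<forall>\<^sub>F s in nhds (a j). central_density k l (a(j := s)) = smear s (mix a ?J (one_sided (a l))) 0"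
        proof eventually_elim
          case (elim s)
          then show ?case
            using mix_smear_one_sided[OF J(1,2), of a s "a l"] cong[of s "smear s (one_sided (a l))"] True kl
            by (simp add: smear_one_sided'[symmetric] l central_density_def)
        qed
      qed
    next
      case False
      then have jl: "j = l" using True by simp
      show ?thesis
      proof
        show "quad_growth (mix a ?J (one_sided (a k)))"
          using k J i by (intro mix_quad_growth[OF _ one_sided_abs_le] isCont_one_sided) auto
        show "\<bar>mix a ?J (one_sided (a k)) x\<bar> \<le> 1 / \<bar>a k\<bar>" for x
          by (rule mix_bounded[OF one_sided_abs_le]) simp
        show "smear (a j) (mix a ?J (one_sided (a k))) = ?p"
          using mix_smear_one_sided[OF J(1,2), of a "a j" "a k"] jl
          by (simp add: smear_one_sided k l)
        have "open {..< 0 :: real}" by simp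
        then have "\<forall>\<^sub>F s in nhds (a j). s \<in> {..<0}"
          using jl l by (intro eventually_nhds_in_open) auto
        then show "\<forall>\<^sub>F s in nhds (a j). central_density k l (a(j := s)) = smear s (mix a ?J (one_sided (a k))) 0"
        proof eventually_elim
          case (elim s)
          then show ?case
            using mix_smear_one_sided[OF J(1,2), of a s "a k"] cong[of s "smear s (one_sided (a k))"] jl kl
            by (simp add: smear_one_sided[symmetric] k central_density_def)
        qed
      qed
    qed
  qed
  have "((\<lambda>s. s * smear s \<phi> 0) has_real_derivative smear (a j) (smear (a j) \<phi>) 0) (at (a j))"
    by (rule times_smear_has_derivative[OF \<phi>(1,2) j])
  moreover have ev': "\<forall>\<^sub>F s in nhds (a j). s * central_density k l (a(j := s)) = s * smear s \<phi> 0"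
    using ev by eventually_elim simp
  ultimately show ?thesis
    unfolding DERIV_cong_ev[OF refl ev' refl] \<phi>(3) by blast
qed

lemma central_density_directional_derivative:
  fixes a :: "'i::finite \<Rightarrow> real"
  assumes k: "0 < a k" and l: "a l < 0" and i: "i \<notin> {k, l}" "a i \<noteq> 0"
  shows "\<exists>D. \<forall>h. ((\<lambda>t. central_density k l (\<lambda>j. a j + t * h j)) has_real_derivative (\<Sum>j\<in>UNIV. h j * D j)) (at 0)"
proof -
  have "finite (- {k, l})" "\<exists>j\<in>- {k, l}. a j \<noteq> 0" using i by auto
  from mix_directional_derivative[OF k l this] obtain A B D where
    D: "\<And>p q h. ((\<lambda>t. mix (\<lambda>j. a j + t * h j) (- {k, l}) (two_sided (a k + t * p) (a l + t * q)) 0)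
    has_real_derivative p * A + q * B + (\<Sum>j\<in>- {k, l}. h j * D j)) (at 0)" by blast
  have kl: "k \<noteq> l" using k l by auto
  define E where "E = D(k := A, l := B)"
  have "((\<lambda>t. central_density k l (\<lambda>j. a j + t * h j)) has_real_derivative (\<Sum>j\<in>UNIV. h j * E j)) (at 0)" for h
  proof -
    have "(\<Sum>j\<in>UNIV. h j * E j) = (\<Sum>j\<in>insert k (insert l (- {k, l})). h j * E j)"
      by (rule sum.cong) auto
    also have "\<dots> = h k * A + h l * B + (\<Sum>j\<in>- {k, l}. h j * E j)"
      using kl by (simp add: E_def)
    also have "(\<Sum>j\<in>- {k, l}. h j * E j) = (\<Sum>j\<in>- {k, l}. h j * D j)"
      by (rule sum.cong) (auto simp: E_def)
    finally show ?thesis using D[of h "h k" "h l"] by (simp add: central_density_def)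
  qed
  then show ?thesis by blast
qed

lemma central_density_scale:
  assumes "0 < r"
  shows "central_density k l (\<lambda>j. r * a j) = central_density k l a / r"
proof -
  have *: "two_sided (r * c) (r * d) (r * x) = two_sided c d x / r" for c d x
    using assms by (simp add: two_sided_def right_diff_distrib[symmetric])
  have "two_sided (r * a k) (r * a l) (0 - (\<Sum>j\<in>- {k, l}. r * a j * y j)) =
      two_sided (a k) (a l) (0 - (\<Sum>j\<in>- {k, l}. a j * y j)) / r" for y
    using *[of "a k" "a l" "0 - (\<Sum>j\<in>- {k, l}. a j * y j)"]
    by (simp add: sum_distrib_left mult.assoc)
  then show ?thesis by (simp add: central_density_def mix_def)
qed

lemma central_density_pos:
  assumes k: "0 < a k" and l: "a l < 0"
  shows "0 < central_density k l a"
proof -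
  let ?M = "\<Pi>\<^sub>M j\<in>- {k, l}. exp_measure"
  interpret prob_space ?M by (rule prob_PiM_exp)
  have i: "integrable ?M (\<lambda>y. two_sided (a k) (a l) (0 - (\<Sum>j\<in>- {k, l}. a j * y j)))"
    by (rule mix_integrable[OF _ two_sided_abs_le[OF k l]]) simp
  have pos: "0 < two_sided (a k) (a l) z" for z by (rule two_sided_bounds[OF k l])
  have "(\<integral>y. 0 \<partial>?M) < (\<integral>y. two_sided (a k) (a l) (0 - (\<Sum>j\<in>- {k, l}. a j * y j)) \<partial>?M)"
    by (rule integral_less_AE_space[OF _ i]) (auto simp: pos emeasure_space_1)
  then show ?thesis by (simp add: central_density_def mix_def)
qed

lemma critical_density_at_most_three:
  fixes a :: "'i::finite \<Rightarrow> real"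
  assumes k: "0 < a k" and l: "a l < 0"
    and sum0: "(\<Sum>j\<in>UNIV. a j) = 0" and sum1: "(\<Sum>j\<in>UNIV. (a j)\<^sup>2) = 1"
    and crit: "\<And>h. (\<Sum>j\<in>UNIV. h j) = 0 \<Longrightarrow> (\<Sum>j\<in>UNIV. a j * h j) = 0 \<Longrightarrow>
      ((\<lambda>t. central_density k l (\<lambda>j. a j + t * h j)) has_real_derivative 0) (at 0)"
  shows "card (range a - {0}) \<le> 3"
proof (rule ccontr)
  assume "\<not> ?thesis"
  then obtain B where B: "B \<subseteq> range a - {0}" "card B = 4"
    using obtain_subset_with_card_n[of 4 "range a - {0}"] by auto
  \<comment> \<open>Two of the four values may be a_k and a_l; any other one belongs to the third
    nonzero coordinate needed for differentiability.\<close>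
  have "\<exists>b\<in>B. b \<notin> {a k, a l}"
  proof (rule ccontr)
    assume "\<not> ?thesis"
    then have "card B \<le> card {a k, a l}" by (intro card_mono) auto
    also have "\<dots> \<le> 2" by (simp add: card_insert_if)
    finally show False using B by simp
  qed
  then obtain b where b: "b \<in> B" "b \<notin> {a k, a l}" by blast
  moreover from b obtain i where "b = a i" "a i \<noteq> 0" using B by blast
  ultimately have i: "i \<notin> {k, l}" "a i \<noteq> 0" by auto
  define \<sigma> where "\<sigma> = central_density k l a"
  have \<sigma>: "0 < \<sigma>" unfolding \<sigma>_def by (rule central_density_pos[OF k l])
  obtain D where D: "\<And>h. ((\<lambda>t. central_density k l (\<lambda>j. a j + t * h j)) has_real_derivative (\<Sum>j\<in>UNIV. h j * D j)) (at 0)"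
    using central_density_directional_derivative[OF k l i] by blast
  \<comment> \<open>Along the ray through a the density is \<sigma> / (1 + t), whose derivative at 0
    is -\<sigma>.\<close>
  have euler: "(\<Sum>j\<in>UNIV. a j * D j) = - \<sigma>"
  proof (rule DERIV_unique[OF D])
    have "\<forall>\<^sub>F t in nhds (0 :: real). t \<in> {-1<..}"
      by (intro eventually_nhds_in_open) auto
    then have ev: "\<forall>\<^sub>F t in nhds 0. central_density k l (\<lambda>j. a j + t * a j) = \<sigma> / (1 + t)"
    proof eventually_elim
      case (elim t)
      then show ?case using central_density_scale[of "1 + t" k l a] by (simp add: \<sigma>_def algebra_simps)
    qed
    show "((\<lambda>t. central_density k l (\<lambda>j. a j + t * a j)) has_real_derivative - \<sigma>) (at 0)"
      unfolding DERIV_cong_ev[OF refl ev refl] by (auto intro!: derivative_eq_intros)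
  qed
  define \<mu> where "\<mu> = (\<Sum>j\<in>UNIV. D j) / CARD('i)"
  have lagrange: "D j = \<mu> - \<sigma> * a j" for j
  proof -
    \<comment> \<open>The projection of the gradient D to the tangent space: \<mu> is the mean of D,
      and \<sigma> compensates the radial component found above. Criticality in the direction h
      itself gives that h is orthogonal to D, hence to itself.\<close>
    define h where "h = (\<lambda>j. D j - \<mu> + \<sigma> * a j)"
    have h0: "(\<Sum>j\<in>UNIV. h j) = 0"
      by (simp add: h_def sum.distrib sum_subtractf sum_distrib_left[symmetric] sum0 \<mu>_def)
    have ah: "(\<Sum>j\<in>UNIV. a j * h j) = 0"
    proof -
      have "(\<Sum>j\<in>UNIV. a j * h j) = (\<Sum>j\<in>UNIV. a j * D j) - \<mu> * (\<Sum>j\<in>UNIV. a j) + \<sigma> * (\<Sum>j\<in>UNIV. (a j)\<^sup>2)"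
        by (simp add: h_def sum.distrib sum_subtractf sum_distrib_left algebra_simps power2_eq_square)
      then show ?thesis by (simp add: euler sum0 sum1)
    qed
    have "(\<Sum>j\<in>UNIV. h j * D j) = 0" by (rule DERIV_unique[OF D crit[OF h0 ah]])
    then have "(\<Sum>j\<in>UNIV. (h j)\<^sup>2) = - \<mu> * (\<Sum>j\<in>UNIV. h j) + \<sigma> * (\<Sum>j\<in>UNIV. a j * h j)"
    proof -
      have "(\<Sum>j\<in>UNIV. (h j)\<^sup>2) = (\<Sum>j\<in>UNIV. h j * D j - \<mu> * h j + \<sigma> * (a j * h j))"
        by (rule sum.cong) (auto simp: h_def algebra_simps power2_eq_square)
      then show ?thesis
        using \<open>(\<Sum>j\<in>UNIV. h j * D j) = 0\<close> by (simp add: sum.distrib sum_subtractf sum_distrib_left sum_negf)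
    qed
    then have "(\<Sum>j\<in>UNIV. (h j)\<^sup>2) = 0" by (simp add: h0 ah)
    then have "h j = 0" by (simp add: sum_nonneg_eq_0_iff)
    then show ?thesis by (simp add: h_def)
  qed
  define p where "p = mix a (- {k, l}) (two_sided (a k) (a l))"
  have p: "quad_growth p" unfolding p_def by (rule two_sided_mix[OF k l]) simp
  have p0: "p 0 = \<sigma>" by (simp add: p_def \<sigma>_def central_density_def)
  \<comment> \<open>Two evaluations of the derivative of s times the density in coordinate j: the
    product rule, and the resolvent form.\<close>
  have smear_p: "smear (a j) p 0 = \<sigma> + a j * D j" if "a j \<noteq> 0" for j
  proof -
    define e where "e = (\<lambda>i. if i = j then 1 else 0 :: real)"
    have e: "(\<lambda>i. a i + t * e i) = a(j := a j + t)" for t by (auto simp: e_def)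
    have "((\<lambda>t. central_density k l (a(j := a j + t))) has_real_derivative D j) (at 0)"
          proof -
      have "(\<Sum>i\<in>UNIV. e i * D i) = (\<Sum>i\<in>UNIV. if i = j then D i else 0)"
        by (rule sum.cong) (auto simp: e_def)
      then show ?thesis using D[of e] by (simp add: e)
    qed
    then have "((\<lambda>s. central_density k l (a(j := s))) has_real_derivative D j) (at (a j))"
      using DERIV_at_within_shift[of "\<lambda>s. central_density k l (a(j := s))" "D j" "a j" 0 UNIV] by simp
    then have "((\<lambda>s. s * central_density k l (a(j := s))) has_real_derivative \<sigma> + a j * D j) (at (a j))"
      by (auto intro!: derivative_eq_intros simp: \<sigma>_def)
    then show ?thesis
      using central_density_coordinate[OF k l i that] unfolding p_def[symmetric] by (rule DERIV_unique[symmetric])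
  qed
  \<comment> \<open>The coefficients are read off from T_c q(0) = q(0) - c q'(0) + c^2 q''(0),
    matched with \<sigma> + \<mu> c - \<sigma> c^2.\<close>
  define q where "q = (\<lambda>x. \<sigma> + (- \<mu>) * x + (- \<sigma> / 2) * x\<^sup>2)"
  have q: "quad_growth q" unfolding q_def by (rule quad_growth_quadratic)
  define r where "r = (\<lambda>x. p x - q x)"
  have "\<exists>S. finite S \<and> card S = 5 \<and> (\<forall>x\<in>S. r x = 0)"
  proof (rule five_zeros)
    show "quad_growth r" unfolding r_def by (intro quad_growth_diff p q)
    show "r 0 = 0" by (simp add: r_def q_def p0)
    show "card B = 4" by (rule B)
    show "0 \<notin> B" using B by auto
    fix b assume "b \<in> B"
    then obtain j where j: "b = a j" "a j \<noteq> 0" using B by auto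
    have "smear b r 0 = smear b p 0 - smear b q 0"
      unfolding r_def smear_diff[OF p q] ..
    also have "\<dots> = 0"
      unfolding j(1) q_def smear_quadratic[OF j(2)] smear_p[OF j(2)] lagrange[of j]
      by (simp add: algebra_simps power2_eq_square)
    finally show "smear b r 0 = 0" .
  qed
  then obtain S where S: "finite S" "card S = 5" "\<And>x. x \<in> S \<Longrightarrow> p x = q x" by (auto simp: r_def)
  have "card S \<le> 4"
    using S \<sigma> unfolding p_def q_def
    by (intro mix_minus_quadratic_zeros[OF k l, of "- \<sigma> / 2" "- {k, l}" S a \<sigma> "- \<mu>"]) auto
  then show False using S by simp
qed

section \<open>Orthonormal coordinates and Lebesgue measure\<close>

interpretation lborelP: product_sigma_finite "\<lambda>_. lborel :: real measure"
  by standard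

text \<open>With c = 1 this is translation invariance; with t = 0 it is the scaling of volume by a
  power of the dimension. The restriction to I keeps the substituted point inside the extensional
  product space.\<close>

lemma nn_integral_PiM_lborel_affine:
  fixes c :: real and t :: "'i \<Rightarrow> real"
  assumes "finite I" "c \<noteq> 0" "f \<in> borel_measurable (\<Pi>\<^sub>M i\<in>I. lborel)"
  shows "(\<integral>\<^sup>+x. f x \<partial>(\<Pi>\<^sub>M i\<in>I. lborel)) =
    ennreal \<bar>c\<bar> ^ card I * (\<integral>\<^sup>+x. f (\<lambda>i\<in>I. t i + c * x i) \<partial>(\<Pi>\<^sub>M i\<in>I. lborel))"
  using assms(1,3)
proof (induction I arbitrary: f rule: finite_induct)
  case empty
  have "(\<integral>\<^sup>+x. f x \<partial>(\<Pi>\<^sub>M i\<in>{}. lborel)) = (\<integral>\<^sup>+x. f (\<lambda>i\<in>{}. t i + c * x i) \<partial>(\<Pi>\<^sub>M i\<in>{}. lborel))"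
    by (intro nn_integral_cong) (auto simp: space_PiM PiE_empty_domain restrict_def)
  then show ?case by (simp only: card.empty power_0 mult_1)
next
  case (insert j J)
  note insert.prems[measurable]
  let ?M = "\<lambda>J. \<Pi>\<^sub>M i\<in>J. (lborel :: real measure)"
  have m1: "(\<lambda>x. \<integral>\<^sup>+y. f (x(j := y)) \<partial>lborel) \<in> borel_measurable (?M J)"
    using insert.hyps by measurable
  have m2: "(\<lambda>x. f (\<lambda>i\<in>insert j J. t i + c * x i)) \<in> borel_measurable (?M (insert j J))"
    by measurable
  have "(\<integral>\<^sup>+x. f x \<partial>?M (insert j J)) = (\<integral>\<^sup>+x. (\<integral>\<^sup>+y. f (x(j := y)) \<partial>lborel) \<partial>?M J)"
    by (rule lborelP.product_nn_integral_insert[OF insert.hyps insert.prems])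
  also have "\<dots> = ennreal \<bar>c\<bar> ^ card J * (\<integral>\<^sup>+x. (\<integral>\<^sup>+y. f ((\<lambda>i\<in>J. t i + c * x i)(j := y)) \<partial>lborel) \<partial>?M J)"
    by (rule insert.IH[OF m1])
  also have "(\<integral>\<^sup>+x. (\<integral>\<^sup>+y. f ((\<lambda>i\<in>J. t i + c * x i)(j := y)) \<partial>lborel) \<partial>?M J) =
      (\<integral>\<^sup>+x. ennreal \<bar>c\<bar> * (\<integral>\<^sup>+y. f ((\<lambda>i\<in>J. t i + c * x i)(j := t j + c * y)) \<partial>lborel) \<partial>?M J)"
  proof (rule nn_integral_cong)
    fix x assume x: "x \<in> space (?M J)"
    have "(\<lambda>y. f ((\<lambda>i\<in>J. t i + c * x i)(j := y))) \<in> borel_measurable borel"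
    proof -
      have "(\<lambda>y. (\<lambda>i\<in>J. t i + c * x i)(j := y)) \<in> lborel \<rightarrow>\<^sub>M ?M (insert j J)"
        by (rule measurable_PiM_single') (auto simp: PiE_iff extensional_def)
      from measurable_compose[OF this insert.prems] show ?thesis by simp
    qed
    from nn_integral_real_affine[OF this assms(2), of "t j"]
    show "(\<integral>\<^sup>+y. f ((\<lambda>i\<in>J. t i + c * x i)(j := y)) \<partial>lborel) =
        ennreal \<bar>c\<bar> * (\<integral>\<^sup>+y. f ((\<lambda>i\<in>J. t i + c * x i)(j := t j + c * y)) \<partial>lborel)" .
  qed
  also have "\<dots> = (\<integral>\<^sup>+x. ennreal \<bar>c\<bar> * (\<integral>\<^sup>+y. f (\<lambda>i\<in>insert j J. t i + c * (x(j := y)) i) \<partial>lborel) \<partial>?M J)"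
  proof -
    have "(\<lambda>i\<in>J. t i + c * x i)(j := t j + c * y) = (\<lambda>i\<in>insert j J. t i + c * (x(j := y)) i)" for x y
      using insert.hyps by (auto simp: restrict_def fun_eq_iff)
    then show ?thesis by simp
  qed
  also have "\<dots> = ennreal \<bar>c\<bar> * (\<integral>\<^sup>+x. (\<integral>\<^sup>+y. f (\<lambda>i\<in>insert j J. t i + c * (x(j := y)) i) \<partial>lborel) \<partial>?M J)"
  proof (rule nn_integral_cmult)
    show "(\<lambda>x. \<integral>\<^sup>+y. f (\<lambda>i\<in>insert j J. t i + c * (x(j := y)) i) \<partial>lborel) \<in> borel_measurable (?M J)"
      using m2 insert.hyps by measurable
  qed
  also have "(\<integral>\<^sup>+x. (\<integral>\<^sup>+y. f (\<lambda>i\<in>insert j J. t i + c * (x(j := y)) i) \<partial>lborel) \<partial>?M J) =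
      (\<integral>\<^sup>+x. f (\<lambda>i\<in>insert j J. t i + c * x i) \<partial>?M (insert j J))"
    by (rule lborelP.product_nn_integral_insert[OF insert.hyps m2, symmetric])
  finally show ?case by (simp only: card_insert_disjoint[OF insert.hyps] power_Suc mult_ac)
qed

text \<open>The residual is orthogonal to the span, which is everything by dimension, hence to
  itself. Families rather than sets are used because the index set is the coordinate type in one
  application and a set of vectors in another.\<close>

lemma orthonormal_family_expansion:
  fixes b :: "'i \<Rightarrow> 'a::euclidean_space"
  assumes I: "finite I" "card I = DIM('a)"
    and orth: "\<And>i j. i \<in> I \<Longrightarrow> j \<in> I \<Longrightarrow> b i \<bullet> b j = (if i = j then 1 else 0)"
  shows "v = (\<Sum>i\<in>I. (v \<bullet> b i) *\<^sub>R b i)"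
proof -
  have inj: "inj_on b I"
    by (rule inj_onI) (metis orth zero_neq_one)
  have po: "pairwise orthogonal (b ` I)"
    using orth by (auto simp: pairwise_def orthogonal_def)
  have "0 \<notin> b ` I" using orth by force
  then have ind: "independent (b ` I)" by (rule pairwise_orthogonal_independent[OF po])
  have "span (b ` I) = UNIV"
    using card_eq_dim[of "b ` I" UNIV] ind I card_image[OF inj] by (auto simp: dim_UNIV)
  then have v: "v \<in> span (b ` I)" by simp
  define u where "u = v - (\<Sum>i\<in>I. (v \<bullet> b i) *\<^sub>R b i)"
  have "u \<bullet> b j = 0" if "j \<in> I" for j
  proof -
    have "(\<Sum>i\<in>I. (v \<bullet> b i) * (b i \<bullet> b j)) = (\<Sum>i\<in>I. if i = j then v \<bullet> b i else 0)"
      by (rule sum.cong) (auto simp: orth that)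
    then show ?thesis using I that by (simp add: u_def inner_diff_left inner_sum_left)
  qed
  then have "orthogonal u z" if "z \<in> span (b ` I)" for z
    using that by (intro orthogonal_to_span[OF that]) (auto simp: orthogonal_def)
  then have "orthogonal u u" using \<open>span (b ` I) = UNIV\<close> by auto
  then show ?thesis by (simp add: u_def orthogonal_self)
qed

text \<open>Two translation invariant measures that give the same finite mass to one even function
  coincide; the Gaussian serves here since it is both rotation invariant and a product.\<close>
lemma nn_integral_orthonormal_family:
  fixes b :: "'i \<Rightarrow> 'a::euclidean_space"
  assumes I: "finite I" "card I = DIM('a)"
    and orth: "\<And>i j. i \<in> I \<Longrightarrow> j \<in> I \<Longrightarrow> b i \<bullet> b j = (if i = j then 1 else 0)"
    and f[measurable]: "f \<in> borel_measurable borel"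
  shows "(\<integral>\<^sup>+x. f (\<Sum>i\<in>I. x i *\<^sub>R b i) \<partial>(\<Pi>\<^sub>M i\<in>I. lborel)) = (\<integral>\<^sup>+v. f v \<partial>lborel)"
proof -
  let ?P = "\<Pi>\<^sub>M i\<in>I. (lborel :: real measure)"
  define \<Phi> where "\<Phi> = (\<lambda>x. \<Sum>i\<in>I. x i *\<^sub>R b i)"
  have \<Phi>[measurable]: "\<Phi> \<in> borel_measurable ?P" unfolding \<Phi>_def by measurable
  define g where "g = (\<lambda>v::'a. ennreal ((1 / sqrt (2 * pi)) ^ DIM('a) * exp (- (v \<bullet> v) / 2)))"
  have g[measurable]: "g \<in> borel_measurable borel" unfolding g_def by measurable
  have nd1: "(\<integral>\<^sup>+x. ennreal (std_normal_density x) \<partial>lborel) = 1"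
    by (subst nn_integral_eq_integral) auto
  have gprod: "(\<Prod>i\<in>J. std_normal_density (x i)) = (1 / sqrt (2 * pi)) ^ card J * exp (- (\<Sum>i\<in>J. (x i)\<^sup>2) / 2)"
    if "finite J" for J :: "'z set" and x :: "'z \<Rightarrow> real"
  proof -
    have "- (\<Sum>i\<in>J. (x i)\<^sup>2) / 2 = (\<Sum>i\<in>J. - (x i)\<^sup>2 / 2)"
      by (simp add: sum_divide_distrib sum_negf)
    then show ?thesis
      unfolding std_normal_density_def by (simp only: exp_sum[OF that] prod.distrib prod_constant)
  qed
  have g1: "(\<integral>\<^sup>+v. g v \<partial>lborel) = 1"
  proof -
    have "g v = (\<Prod>i\<in>Basis. ennreal (std_normal_density (v \<bullet> i)))" for v
      unfolding g_def
      by (subst prod_ennreal) (auto simp: gprod euclidean_inner[of v v] power2_eq_square)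
    then have "(\<integral>\<^sup>+v. g v \<partial>lborel) = (\<Prod>i\<in>(Basis::'a set). \<integral>\<^sup>+x. ennreal (std_normal_density x) \<partial>lborel)"
      using nn_integral_lborel_prod[of "\<lambda>_ x. ennreal (std_normal_density x)"] by simp
    then show ?thesis by (simp add: nd1)
  qed
  have \<Phi>\<Phi>: "\<Phi> x \<bullet> \<Phi> x = (\<Sum>i\<in>I. (x i)\<^sup>2)" for x
  proof -
    have "\<Phi> x \<bullet> \<Phi> x = (\<Sum>i\<in>I. \<Sum>j\<in>I. x i * (x j * (b i \<bullet> b j)))"
      by (simp add: \<Phi>_def inner_sum_left inner_sum_right sum_distrib_left inner_commute mult.left_commute)
    also have "\<dots> = (\<Sum>i\<in>I. \<Sum>j\<in>I. if i = j then (x i)\<^sup>2 else 0)"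
      by (intro sum.cong) (auto simp: orth power2_eq_square)
    also have "\<dots> = (\<Sum>i\<in>I. (x i)\<^sup>2)" using I by simp
    finally show ?thesis .
  qed
  have g2: "(\<integral>\<^sup>+x. g (\<Phi> x) \<partial>?P) = 1"
  proof -
    have "g (\<Phi> x) = (\<Prod>i\<in>I. ennreal (std_normal_density (x i)))" for x
      unfolding g_def by (subst prod_ennreal) (auto simp: gprod I \<Phi>\<Phi>)
    then have "(\<integral>\<^sup>+x. g (\<Phi> x) \<partial>?P) = (\<Prod>i\<in>I. \<integral>\<^sup>+x. ennreal (std_normal_density x) \<partial>lborel)"
      using lborelP.product_nn_integral_prod[OF I(1), of "\<lambda>_ x. ennreal (std_normal_density x)"] by simp
    then show ?thesis by (simp add: nd1)
  qed
  have shift: "(\<integral>\<^sup>+x. h (\<Phi> x + v) \<partial>?P) = (\<integral>\<^sup>+x. h (\<Phi> x) \<partial>?P)"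
    if [measurable]: "h \<in> borel_measurable borel" for h :: "'a \<Rightarrow> ennreal" and v
  proof -
    have "\<Phi> (\<lambda>i\<in>I. v \<bullet> b i + 1 * x i) = \<Phi> x + v" for x
      using orthonormal_family_expansion[OF I orth, of v]
      by (simp add: \<Phi>_def scaleR_left_distrib sum.distrib add.commute)
    then show ?thesis
      using nn_integral_PiM_lborel_affine[OF I(1), of 1 "\<lambda>x. h (\<Phi> x)" "\<lambda>i. v \<bullet> b i"] by simp
  qed
  have shift': "(\<integral>\<^sup>+y. h (v + y) \<partial>lborel) = (\<integral>\<^sup>+y. h y \<partial>lborel)"
    if [measurable]: "h \<in> borel_measurable borel" for h :: "'a \<Rightarrow> ennreal" and v
    using nn_integral_distr[of "(+) v" lborel borel h] by (simp add: lborel_distr_plus)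
  interpret P: sigma_finite_measure ?P by (rule lborelP.sigma_finite[OF I(1)])
  interpret pair_sigma_finite ?P "lborel :: 'a measure" ..
  have even: "(\<integral>\<^sup>+x. g (y - \<Phi> x) \<partial>?P) = 1" for y
  proof -
    have "g (y - \<Phi> x) = g (\<Phi> x + (- y))" for x
      by (simp add: g_def inner_diff_left inner_diff_right inner_commute algebra_simps)
    then show ?thesis using shift[OF g, of "- y"] g2 by simp
  qed
  \<comment> \<open>Insert the total mass 1 of g, translate the coordinate integral by y, exchange,
    translate the Lebesgue integral by \<Phi> x, and exchange again; the inner integral of g is then
    1.\<close>
  have "(\<integral>\<^sup>+x. f (\<Phi> x) \<partial>?P) = (\<integral>\<^sup>+y. g y * (\<integral>\<^sup>+x. f (\<Phi> x) \<partial>?P) \<partial>lborel)"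
    by (subst nn_integral_multc) (auto simp: g1)
  also have "\<dots> = (\<integral>\<^sup>+y. (\<integral>\<^sup>+x. g y * f (\<Phi> x + y) \<partial>?P) \<partial>lborel)"
    by (intro nn_integral_cong) (simp add: nn_integral_cmult shift)
  also have "\<dots> = (\<integral>\<^sup>+x. (\<integral>\<^sup>+y. g y * f (\<Phi> x + y) \<partial>lborel) \<partial>?P)"
    by (rule Fubini') measurable
  also have "\<dots> = (\<integral>\<^sup>+x. (\<integral>\<^sup>+y. g (y - \<Phi> x) * f y \<partial>lborel) \<partial>?P)"
  proof (rule nn_integral_cong)
    fix x
    show "(\<integral>\<^sup>+y. g y * f (\<Phi> x + y) \<partial>lborel) = (\<integral>\<^sup>+y. g (y - \<Phi> x) * f y \<partial>lborel)"
      using shift'[of "\<lambda>y. g (y - \<Phi> x) * f y" "\<Phi> x"] by simp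
  qed
  also have "\<dots> = (\<integral>\<^sup>+y. (\<integral>\<^sup>+x. g (y - \<Phi> x) * f y \<partial>?P) \<partial>lborel)"
    by (rule Fubini'[symmetric]) measurable
  also have "\<dots> = (\<integral>\<^sup>+y. f y \<partial>lborel)"
    by (intro nn_integral_cong) (simp add: nn_integral_multc even)
  finally show ?thesis by (simp add: \<Phi>_def)
qed

text \<open>A product of measures with densities has the product density, as one sees on
  boxes.\<close>

lemma nn_integral_PiM_exp_measure:
  assumes I: "finite I" and h[measurable]: "h \<in> borel_measurable (\<Pi>\<^sub>M i\<in>I. borel)"
  shows "(\<integral>\<^sup>+y. h y \<partial>(\<Pi>\<^sub>M i\<in>I. exp_measure)) =
    (\<integral>\<^sup>+y. (\<Prod>i\<in>I. ennreal (exponential_density 1 (y i))) * h y \<partial>(\<Pi>\<^sub>M i\<in>I. lborel))"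
proof -
  let ?w = "\<lambda>y. \<Prod>i\<in>I. ennreal (exponential_density 1 (y i))"
  have s: "sets (\<Pi>\<^sub>M i\<in>I. (lborel :: real measure)) = sets (\<Pi>\<^sub>M i\<in>I. exp_measure)"
    "sets (\<Pi>\<^sub>M i\<in>I. (lborel :: real measure)) = sets (\<Pi>\<^sub>M i\<in>I. borel)"
    by (auto intro!: sets_PiM_cong)
  have [measurable]: "?w \<in> borel_measurable (\<Pi>\<^sub>M i\<in>I. (lborel :: real measure))" by measurable
  have hm: "h \<in> borel_measurable (\<Pi>\<^sub>M i\<in>I. (lborel :: real measure))"
    using h s(2) measurable_cong_sets by blast
  have "density (\<Pi>\<^sub>M i\<in>I. (lborel :: real measure)) ?w = (\<Pi>\<^sub>M i\<in>I. exp_measure)"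
  proof (rule expP.PiM_eqI[OF I])
    show "sets (density (\<Pi>\<^sub>M i\<in>I. (lborel :: real measure)) ?w) = sets (\<Pi>\<^sub>M i\<in>I. exp_measure)"
      using s by simp
    fix A :: "'a \<Rightarrow> real set" assume A: "\<And>i. i \<in> I \<Longrightarrow> A i \<in> sets exp_measure"
    have m: "Pi\<^sub>E I A \<in> sets (\<Pi>\<^sub>M i\<in>I. (lborel :: real measure))"
      using A I by (intro sets_PiM_I_finite) auto
    have "emeasure (density (\<Pi>\<^sub>M i\<in>I. (lborel :: real measure)) ?w) (Pi\<^sub>E I A) =
       (\<integral>\<^sup>+y. (\<Prod>i\<in>I. ennreal (exponential_density 1 (y i)) * indicator (A i) (y i)) \<partial>(\<Pi>\<^sub>M i\<in>I. lborel))"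
    proof -
      have "indicator (Pi\<^sub>E I A) y = (\<Prod>i\<in>I. indicator (A i) (y i) :: ennreal)"
        if "y \<in> space (\<Pi>\<^sub>M i\<in>I. (lborel :: real measure))" for y
      proof (cases "y \<in> Pi\<^sub>E I A")
        case True
        then show ?thesis by (auto simp: PiE_iff)
      next
        case False
        moreover have "y \<in> extensional I" using that by (simp add: space_PiM PiE_def)
        ultimately obtain i where "i \<in> I" "y i \<notin> A i" by (auto simp: PiE_iff)
        then have "(\<Prod>i\<in>I. indicator (A i) (y i) :: ennreal) = 0" using I by (intro prod_zero) (auto intro!: bexI[of _ i])
        then show ?thesis using False by simp
      qed
      then show ?thesis using m I
        by (subst emeasure_density) (auto intro!: nn_integral_cong simp: prod.distrib)
    qed
    also have "\<dots> = (\<Prod>i\<in>I. \<integral>\<^sup>+y. ennreal (exponential_density 1 y) * indicator (A i) y \<partial>lborel)"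
      using A by (intro lborelP.product_nn_integral_prod I) auto
    also have "\<dots> = (\<Prod>i\<in>I. emeasure exp_measure (A i))"
      unfolding exp_measure_def using A by (intro prod.cong) (auto simp: emeasure_density)
    finally show "emeasure (density (\<Pi>\<^sub>M i\<in>I. (lborel :: real measure)) ?w) (Pi\<^sub>E I A) = (\<Prod>i\<in>I. emeasure exp_measure (A i))" .
  qed
  then show ?thesis
    using nn_integral_density[of ?w "\<Pi>\<^sub>M i\<in>I. (lborel :: real measure)" h] hm by simp
qed

section \<open>The volume of a central section\<close>

lemma standard_simplex_iff:
  "x \<in> (standard_simplex :: (real ^ 'm) set) \<longleftrightarrow> (\<forall>j. 0 \<le> x $ j) \<and> (\<Sum>j\<in>UNIV. x $ j) = 1"
proof
  let ?S = "{x :: real ^ 'm. (\<forall>j. 0 \<le> x $ j) \<and> (\<Sum>j\<in>UNIV. x $ j) = 1}"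
  assume "x \<in> (standard_simplex :: (real ^ 'm) set)"
  moreover have "convex hull (range (\<lambda>j. axis j 1)) \<subseteq> ?S"
  proof (rule hull_minimal)
    show "range (\<lambda>j. axis j 1) \<subseteq> ?S" by (auto simp: axis_def)
    show "convex ?S"
    proof (rule convexI)
      fix x y :: "real ^ 'm" and u v :: real
      assume xy: "x \<in> ?S" "y \<in> ?S" "0 \<le> u" "0 \<le> v" "u + v = 1"
      then have "(\<Sum>j\<in>UNIV. u * x $ j + v * y $ j) = 1"
        by (simp add: sum.distrib sum_distrib_left[symmetric])
      with xy show "u *\<^sub>R x + v *\<^sub>R y \<in> ?S" by simp
    qed
  qed
  ultimately show "(\<forall>j. 0 \<le> x $ j) \<and> (\<Sum>j\<in>UNIV. x $ j) = 1"
    by (auto simp: standard_simplex_def)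
next
  assume x: "(\<forall>j. 0 \<le> x $ j) \<and> (\<Sum>j\<in>UNIV. x $ j) = 1"
  have "(\<Sum>j\<in>UNIV. x $ j *\<^sub>R axis j 1) \<in> convex hull (range (\<lambda>j. axis j 1 :: real ^ 'm))"
    using x by (intro convex_sum convex_convex_hull) (auto intro: hull_inc)
  then show "x \<in> standard_simplex"
    using basis_expansion[of x] by (simp add: standard_simplex_def scalar_mult_eq_scaleR)
qed

lemma section_iff:
  fixes a :: "real ^ 'm"
  shows "x \<in> standard_simplex \<inter> {x. a \<bullet> x = 0} \<longleftrightarrow>
    (\<forall>j. 0 \<le> x $ j) \<and> (\<Sum>j\<in>UNIV. x $ j) = 1 \<and> a \<bullet> x = 0"
  by (auto simp: standard_simplex_iff)

definition center :: "real ^ 'm" where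
  "center = (\<chi> j. 1 / CARD('m))"

lemma center_in_section:
  fixes a :: "real ^ 'm"
  assumes "(\<Sum>j\<in>UNIV. a $ j) = 0"
  shows "center \<in> standard_simplex \<inter> {x. a \<bullet> x = 0}"
  unfolding section_iff using assms by (simp add: center_def inner_vec_def sum_divide_distrib[symmetric])

text \<open>The space is the orthogonal complement of a and the all-ones vector, which are
  orthogonal and nonzero on the manifold, hence independent.\<close>

lemma dim_normal_tangent_space:
  fixes a :: "real ^ 'm"
  assumes a: "a \<in> normal_manifold"
  shows "dim (normal_tangent_space a) = CARD('m) - 2" "subspace (normal_tangent_space a)"
proof -
  let ?o = "\<chi> j. 1 :: real ^ 'm"
  have ao: "orthogonal a ?o" "a \<noteq> 0"
    using a by (auto simp: normal_manifold_def orthogonal_def inner_vec_def)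
  have "?o \<noteq> 0" by (simp add: vec_eq_iff)
  have "a \<noteq> ?o" using ao by (auto simp: orthogonal_self)
  have "independent {a, ?o}"
    using ao \<open>?o \<noteq> 0\<close> by (intro pairwise_orthogonal_independent) (auto simp: pairwise_insert orthogonal_commute)
  then have 2: "dim (span {a, ?o}) = 2"
    using \<open>a \<noteq> ?o\<close> by (simp add: dim_eq_card_independent)
  have T: "normal_tangent_space a = {y \<in> UNIV. \<forall>x\<in>span {a, ?o}. orthogonal x y}"
  proof -
    have "(\<forall>x\<in>span {a, ?o}. orthogonal x y) \<longleftrightarrow> orthogonal a y \<and> orthogonal ?o y" for y
    proof
      assume "orthogonal a y \<and> orthogonal ?o y"
      then have "orthogonal y x" if "x \<in> span {a, ?o}" for x
        using that by (intro orthogonal_to_span[OF that]) (auto simp: orthogonal_commute)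
      then show "\<forall>x\<in>span {a, ?o}. orthogonal x y" by (simp add: orthogonal_commute)
    qed (auto intro: span_base)
    then show ?thesis
      by (auto simp: normal_tangent_space_def orthogonal_def inner_vec_def)
  qed
  have "dim (normal_tangent_space a) + dim (span {a, ?o}) = dim (UNIV :: (real ^ 'm) set)"
    unfolding T by (rule dim_subspace_orthogonal_to_vectors) auto
  then show "dim (normal_tangent_space a) = CARD('m) - 2" using 2 by simp
  show "subspace (normal_tangent_space a)"
    unfolding T using subspace_orthogonal_to_vectors[of "span {a, ?o}"] by simp
qed

text \<open>Guarantees that the choice inside \<open>flat_volume\<close> is not vacuous. The witness
  is the barycentre together with an orthonormal basis of the tangent space.\<close>

lemma ex_orthonormal_frame_section:
  fixes a :: "real ^ 'm"
  assumes a: "a \<in> normal_manifold"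
  shows "\<exists>p B. orthonormal_frame (CARD('m) - 2) (standard_simplex \<inter> {x. a \<bullet> x = 0}) p B"
proof -
  let ?T = "normal_tangent_space a"
  note T = dim_normal_tangent_space[OF a]
  obtain B where B: "B \<subseteq> ?T" "pairwise orthogonal B" "\<And>x. x \<in> B \<Longrightarrow> norm x = 1"
    "independent B" "card B = dim ?T" "span B = ?T"
    using orthonormal_basis_subspace[OF T(2)] by metis
  have "x \<in> (+) center ` span B" if x: "x \<in> standard_simplex \<inter> {x. a \<bullet> x = 0}" for x
  proof (rule image_eqI)
    have "center \<in> standard_simplex \<inter> {x. a \<bullet> x = 0}"
      using a by (intro center_in_section) (simp add: normal_manifold_def)
    then show "x - center \<in> span B"
      using x unfolding section_iff B(6) by (simp add: normal_tangent_space_def sum_subtractf inner_diff_right)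
  qed simp
  then have "orthonormal_frame (CARD('m) - 2) (standard_simplex \<inter> {x. a \<bullet> x = 0}) center B"
    unfolding orthonormal_frame_def using B T(1) by (auto dest: independent_imp_finite)
  then show ?thesis by blast
qed

text \<open>The centroid is an interior point of the simplex, so the section spans the flat.\<close>
lemma orthonormal_frame_section:
  fixes a :: "real ^ 'm"
  assumes a: "a \<in> normal_manifold"
    and fr: "orthonormal_frame (CARD('m) - 2) (standard_simplex \<inter> {x. a \<bullet> x = 0}) p B"
  shows "span B = normal_tangent_space a" "p - center \<in> normal_tangent_space a"
proof -
  let ?T = "normal_tangent_space a" and ?S = "standard_simplex \<inter> {x. a \<bullet> x = 0}"
  note T = dim_normal_tangent_space[OF a]
  have B: "finite B" "card B = CARD('m) - 2" "pairwise orthogonal B" "\<And>b. b \<in> B \<Longrightarrow> norm b = 1"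
    "?S \<subseteq> (+) p ` span B"
    using fr by (auto simp: orthonormal_frame_def)
  have sub: "x - p \<in> span B" if "x \<in> ?S" for x using B(5) that by auto
  have c: "center \<in> ?S" using a by (intro center_in_section) (simp add: normal_manifold_def)
  have "?T \<subseteq> span B"
  proof
    fix v assume v: "v \<in> ?T"
    \<comment> \<open>Small enough that \<epsilon> |v_j| never exceeds 1 / CARD('m), the common
      coordinate of the barycentre.\<close>
    define \<epsilon> where "\<epsilon> = 1 / (CARD('m) * (norm v + 1))"
    have \<epsilon>: "0 < \<epsilon>" unfolding \<epsilon>_def by (simp add: add_nonneg_pos)
    have "center + \<epsilon> *\<^sub>R v \<in> ?S"
    proof -
      have "0 \<le> (center + \<epsilon> *\<^sub>R v) $ j" for j
      proof -
        have "\<bar>v $ j\<bar> \<le> norm v + 1" using component_le_norm_cart[of v j] by simp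
        then have "\<epsilon> * \<bar>v $ j\<bar> \<le> \<epsilon> * (norm v + 1)" using \<epsilon> by (intro mult_left_mono) auto
        also have "\<dots> = 1 / CARD('m)"
        proof -
          have "norm v + 1 \<noteq> 0" using norm_ge_zero[of v] by linarith
          then show ?thesis by (simp add: \<epsilon>_def)
        qed
        finally have "\<bar>\<epsilon> * v $ j\<bar> \<le> 1 / CARD('m)" using \<epsilon> by (simp add: abs_mult)
        then show ?thesis by (simp add: center_def)
      qed
      moreover have "(\<Sum>j\<in>UNIV. (center + \<epsilon> *\<^sub>R v) $ j) = 1"
        using v c unfolding section_iff
        by (simp add: normal_tangent_space_def sum.distrib sum_distrib_left[symmetric])
      moreover have "a \<bullet> (center + \<epsilon> *\<^sub>R v) = 0"
        using v c unfolding section_iff by (simp add: normal_tangent_space_def inner_add_right)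
      ultimately show ?thesis unfolding section_iff by blast
    qed
    from span_diff[OF sub[OF this] sub[OF c]] have "\<epsilon> *\<^sub>R v \<in> span B" by (simp add: algebra_simps)
    then have "(1 / \<epsilon>) *\<^sub>R \<epsilon> *\<^sub>R v \<in> span B" by (rule span_scale)
    then show "v \<in> span B" using \<epsilon> by simp
  qed
  moreover have "dim (span B) \<le> dim ?T"
    using dim_le_card'[OF B(1)] B(2) T(1) by simp
  ultimately show *: "span B = ?T"
    using subspace_dim_equal[OF T(2) subspace_span] by metis
  show "p - center \<in> ?T"
    using sub[OF c] span_neg[of "center - p" B] unfolding * by (simp add: minus_diff_eq)
qed

text \<open>The volume is read off an integral over a slab around the hyperplane, computed in two
  coordinate systems. The slab is projected along a coordinate axis, which makes the inner integral
  over one coordinate trivial in both of them.\<close>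
definition cone_weight :: "real ^ 'm \<Rightarrow> ennreal" where
  "cone_weight z = indicator {z. \<forall>j. 0 \<le> z $ j} z * ennreal (exp (- (\<Sum>j\<in>UNIV. z $ j)))"

definition slab_integral :: "'m \<Rightarrow> real ^ 'm \<Rightarrow> ennreal" where
  "slab_integral k a = (\<integral>\<^sup>+x. cone_weight (x - ((a \<bullet> x) / a $ k) *\<^sub>R axis k 1) * indicator {0..1} (a \<bullet> x) \<partial>lborel)"

lemma cone_weight_measurable [measurable]: "cone_weight \<in> borel_measurable borel"
proof -
  have [measurable]: "{z :: real ^ 'm. \<forall>j. 0 \<le> z $ j} \<in> sets borel"
    by (intro borel_closed closed_Collect_all closed_Collect_le continuous_intros)
  have [measurable]: "(\<lambda>z :: real ^ 'm. \<Sum>j\<in>UNIV. z $ j) \<in> borel_measurable borel"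
    by (intro borel_measurable_continuous_onI continuous_intros)
  show ?thesis unfolding cone_weight_def[abs_def] by measurable
qed

text \<open>In the standard coordinates the projection makes the weight independent of coordinate k,
  and the slab restricts that coordinate to an interval of length 1 / a_k. What remains is the
  one-sided density at minus the sum over the other coordinates, under the exponential law;
  integrating coordinate l makes the kernel two-sided.\<close>

lemma slab_integral_density:
  fixes a :: "real ^ 'm"
  assumes k: "0 < a $ k" and l: "a $ l < 0"
  shows "slab_integral k a = ennreal (central_density k l (\<lambda>j. a $ j))"
proof -
  let ?K = "- {k}" and ?J = "- {k, l}"
  let ?L = "\<lambda>I. \<Pi>\<^sub>M j\<in>I. (lborel :: real measure)"
  let ?E = "\<lambda>I. \<Pi>\<^sub>M j\<in>I. exp_measure"
  define S where "S = (\<lambda>y. \<Sum>j\<in>?K. a $ j * y j)"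
  define F where "F = (\<lambda>x. cone_weight (x - ((a \<bullet> x) / a $ k) *\<^sub>R axis k 1) * indicator {0..1} (a \<bullet> x))"
  have kl: "k \<noteq> l" using k l by auto
  have U: "(UNIV :: 'm set) = insert k ?K" by auto
  have K: "?K = insert l ?J" using kl by auto
  define \<Phi> where "\<Phi> = (\<lambda>y. \<Sum>j\<in>(UNIV :: 'm set). y j *\<^sub>R axis j (1 :: real))"
  have \<Phi>: "\<Phi> y $ j = y j" for y j
  proof -
    have "\<Phi> y $ j = (\<Sum>i\<in>UNIV. if i = j then y i else 0)"
      unfolding \<Phi>_def sum_component by (rule sum.cong) (auto simp: axis_def)
    then show ?thesis by simp
  qed
  have Fm: "F \<in> borel_measurable borel" unfolding F_def by measurable
  have "slab_integral k a = (\<integral>\<^sup>+y. F (\<Phi> y) \<partial>?L UNIV)"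
    unfolding slab_integral_def F_def[symmetric] \<Phi>_def
    by (rule nn_integral_orthonormal_family[symmetric, OF _ _ _ Fm]) (auto simp: inner_axis_axis)
  also have "\<dots> = (\<integral>\<^sup>+y. (\<integral>\<^sup>+s. F (\<Phi> (y(k := s))) \<partial>lborel) \<partial>?L ?K)"
    unfolding U
  proof (rule lborelP.product_nn_integral_insert)
    have "\<Phi> \<in> borel_measurable (?L UNIV)" unfolding \<Phi>_def by measurable
    from measurable_compose[OF this Fm]
    show "(\<lambda>y. F (\<Phi> y)) \<in> borel_measurable (?L (insert k ?K))" unfolding U[symmetric] .
  qed auto
  also have "\<dots> = (\<integral>\<^sup>+y. (\<Prod>j\<in>?K. ennreal (exponential_density 1 (y j))) * ennreal (one_sided (a $ k) (0 - S y)) \<partial>?L ?K)"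
  proof (rule nn_integral_cong)
    fix y :: "'m \<Rightarrow> real"
    have dot: "a \<bullet> \<Phi> (y(k := s)) = S y + a $ k * s" for s
    proof -
      have "a \<bullet> \<Phi> (y(k := s)) = (\<Sum>j\<in>insert k ?K. a $ j * (y(k := s)) j)"
        unfolding U[symmetric] inner_vec_def \<Phi> by simp
      also have "\<dots> = S y + a $ k * s"
        unfolding S_def by (rule sum_insert_upd) auto
      finally show ?thesis .
    qed
    \<comment> \<open>The projection of the point to the hyperplane along axis k: entry k is
      determined by the other entries and s has disappeared.\<close>
    define z :: "real ^ 'm" where "z = (\<chi> j. if j = k then - S y / a $ k else y j)"
    have z: "\<Phi> (y(k := s)) - ((S y + a $ k * s) / a $ k) *\<^sub>R axis k 1 = z" for s
      using k by (auto simp: vec_eq_iff \<Phi> z_def axis_def field_simps)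
    have "(\<integral>\<^sup>+s. F (\<Phi> (y(k := s))) \<partial>lborel) = (\<integral>\<^sup>+s. cone_weight z * indicator {- S y / a $ k..(1 - S y) / a $ k} s \<partial>lborel)"
      unfolding F_def dot z using k by (intro nn_integral_cong) (auto simp: indicator_def field_simps)
    also have "\<dots> = cone_weight z * ennreal (1 / a $ k)"
    proof -
      have "- S y / a $ k \<le> (1 - S y) / a $ k" using k by (intro divide_right_mono) auto
      moreover have "(1 - S y) / a $ k - (- S y / a $ k) = 1 / a $ k"
        unfolding diff_divide_distrib[symmetric] by simp
      ultimately show ?thesis by (simp add: nn_integral_cmult_indicator)
    qed
    also have "\<dots> = (\<Prod>j\<in>?K. ennreal (exponential_density 1 (y j))) * ennreal (one_sided (a $ k) (0 - S y))"
    proof (cases "\<forall>j\<in>?K. 0 \<le> y j")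
      case False
      then obtain j where "j \<in> ?K" "\<not> 0 \<le> y j" by blast
      then have j: "j \<noteq> k" "y j < 0" by auto
      then have "(\<Prod>j\<in>?K. ennreal (exponential_density 1 (y j))) = 0"
        by (intro prod_zero) (auto simp: exponential_density_def intro!: bexI[of _ j])
      moreover have "cone_weight z = 0"
      proof -
        have "\<not> 0 \<le> z $ j" using j by (simp add: z_def)
        then show ?thesis unfolding cone_weight_def by (auto simp: indicator_def)
      qed
      ultimately show ?thesis by simp
    next
      case True
      have "(\<Prod>j\<in>?K. ennreal (exponential_density 1 (y j))) = ennreal (exp (- (\<Sum>j\<in>?K. y j)))"
      proof -
        have "(\<Prod>j\<in>?K. ennreal (exponential_density 1 (y j))) = (\<Prod>j\<in>?K. ennreal (exp (- y j)))"
          using True by (intro prod.cong) (auto simp: exponential_density_def not_less)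
        then show ?thesis by (simp add: prod_ennreal exp_sum[symmetric] sum_negf[symmetric])
      qed
      moreover have "(\<Sum>j\<in>UNIV. z $ j) = - S y / a $ k + (\<Sum>j\<in>?K. y j)"
      proof -
        have "(\<Sum>j\<in>UNIV. z $ j) = (\<Sum>j\<in>insert k ?K. z $ j)" unfolding U[symmetric] ..
        also have "\<dots> = z $ k + (\<Sum>j\<in>?K. z $ j)" by simp
        also have "(\<Sum>j\<in>?K. z $ j) = (\<Sum>j\<in>?K. y j)" by (rule sum.cong) (auto simp: z_def)
        finally show ?thesis by (simp add: z_def)
      qed
      moreover have "(\<forall>j. 0 \<le> z $ j) \<longleftrightarrow> 0 \<le> - S y / a $ k"
        using True by (auto simp: z_def)
      ultimately show ?thesis
        using k unfolding cone_weight_def one_sided_def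
        by (auto simp: indicator_def ennreal_mult'[symmetric] exp_add[symmetric] field_simps)
    qed
    finally show "(\<integral>\<^sup>+s. F (\<Phi> (y(k := s))) \<partial>lborel) =
      (\<Prod>j\<in>?K. ennreal (exponential_density 1 (y j))) * ennreal (one_sided (a $ k) (0 - S y))" .
  qed
  also have "\<dots> = (\<integral>\<^sup>+y. ennreal (one_sided (a $ k) (0 - S y)) \<partial>?E ?K)"
    by (rule nn_integral_PiM_exp_measure[symmetric]) (simp_all add: S_def)
  also have "\<dots> = (\<integral>\<^sup>+y. (\<integral>\<^sup>+s. ennreal (one_sided (a $ k) (0 - S (y(l := s)))) \<partial>exp_measure) \<partial>?E ?J)"
    unfolding K by (rule expP.product_nn_integral_insert) (auto simp: S_def)
  also have "\<dots> = (\<integral>\<^sup>+y. ennreal (two_sided (a $ k) (a $ l) (0 - (\<Sum>j\<in>?J. a $ j * y j))) \<partial>?E ?J)"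
  proof (rule nn_integral_cong)
    fix y :: "'m \<Rightarrow> real"
    have "0 - S (y(l := s)) = (0 - (\<Sum>j\<in>?J. a $ j * y j)) - a $ l * s" for s
      unfolding S_def K by (subst sum_insert_upd) auto
    then show "(\<integral>\<^sup>+s. ennreal (one_sided (a $ k) (0 - S (y(l := s)))) \<partial>exp_measure) =
        ennreal (two_sided (a $ k) (a $ l) (0 - (\<Sum>j\<in>?J. a $ j * y j)))"
      by (simp only: nn_integral_one_sided[OF k l])
  qed
  also have "\<dots> = ennreal (central_density k l (\<lambda>j. a $ j))"
    unfolding central_density_def mix_def
    by (rule nn_integral_eq_integral[OF mix_integrable[OF _ two_sided_abs_le[OF k l]]])
       (auto simp: two_sided_bounds[OF k l] less_imp_le)
  finally show ?thesis .
qed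

lemma normal_tangent_space_iff:
  "v \<in> normal_tangent_space a \<longleftrightarrow> (\<Sum>j\<in>UNIV. v $ j) = 0 \<and> a \<bullet> v = 0"
  by (simp add: normal_tangent_space_def)

text \<open>In coordinates along a, along the unit all-ones direction e, and along B, the slab
  contributes a factor 1. The slice of the cone at coordinate sum r is r times the section, so it
  has r^d times its volume with d = CARD('m) - 2. The weight e^(-r) gives the Gamma integral d!, and
  r = sqrt M * t gives the factor 1 / sqrt M. The frame is arbitrary, since
  \<open>flat_volume\<close> picks an unknown one.\<close>

lemma slab_integral_section:
  fixes a :: "real ^ 'm"
  assumes a: "a \<in> normal_manifold" and k: "0 < a $ k" and m: "2 \<le> CARD('m)"
    and fr: "orthonormal_frame (CARD('m) - 2) (standard_simplex \<inter> {x. a \<bullet> x = 0}) p B"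
  shows "slab_integral k a = ennreal (fact (CARD('m) - 2) / sqrt (CARD('m))) *
     emeasure (\<Pi>\<^sub>M b\<in>B. (lborel :: real measure))
       {x \<in> space (\<Pi>\<^sub>M b\<in>B. (lborel :: real measure)). p + (\<Sum>b\<in>B. x b *\<^sub>R b) \<in> standard_simplex \<inter> {x. a \<bullet> x = 0}}"
proof -
  let ?L = "\<lambda>I :: (real ^ 'm) set. \<Pi>\<^sub>M b\<in>I. (lborel :: real measure)"
  define M where "M = CARD('m)"
  have M: "2 \<le> M" "0 < sqrt M" using m by (auto simp: M_def)
  define d where "d = M - 2"
  define e :: "real ^ 'm" where "e = (\<chi> j. 1 / sqrt M)"
  have B: "finite B" "card B = d" "pairwise orthogonal B" "\<And>b. b \<in> B \<Longrightarrow> norm b = 1"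
    using fr by (auto simp: orthonormal_frame_def d_def M_def)
  note T = orthonormal_frame_section[OF a fr]
  have BT: "b \<in> normal_tangent_space a" if "b \<in> B" for b
    using that T(1) span_base by blast
  have asum: "(\<Sum>j\<in>UNIV. a $ j) = 0" and aa: "a \<bullet> a = 1"
    using a by (auto simp: normal_manifold_def inner_vec_def power2_eq_square)
  have edot: "e \<bullet> v = (\<Sum>j\<in>UNIV. v $ j) / sqrt M" for v
    by (simp add: e_def inner_vec_def sum_divide_distrib)
  have ee: "e \<bullet> e = 1" unfolding edot using M by (simp add: e_def M_def[symmetric] real_div_sqrt)
  have esum: "(\<Sum>j\<in>UNIV. e $ j) = sqrt M"
    using M by (simp add: e_def M_def[symmetric] real_div_sqrt)
  have center: "center = (1 / sqrt M) *\<^sub>R e"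
    using M by (simp add: center_def e_def vec_eq_iff M_def[symmetric])
  have ea: "e \<bullet> a = 0" "a \<bullet> e = 0" using asum by (simp_all add: edot inner_commute[of a])
  have Bo: "b \<bullet> c = (if b = c then 1 else 0)" if "b \<in> B" "c \<in> B" for b c
    using B(3,4) that by (auto simp: pairwise_def orthogonal_def norm_eq_1)
  have Be: "b \<bullet> e = 0" "e \<bullet> b = 0" and Ba: "b \<bullet> a = 0" "a \<bullet> b = 0" and Bs: "(\<Sum>j\<in>UNIV. b $ j) = 0" if "b \<in> B" for b
    using BT[OF that] by (simp_all add: normal_tangent_space_iff inner_commute[of b] edot)
  have eB: "e \<notin> B" using Be(1)[of e] ee by auto
  have aB: "a \<notin> B" using Ba(1)[of a] aa by auto
  have ae: "a \<noteq> e" using ea aa by auto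
  define C where "C = insert e B"
  have C: "finite C" "a \<notin> C" "card (insert a C) = DIM(real ^ 'm)"
    using B eB aB ae M by (auto simp: C_def d_def M_def)
  have orth: "b \<bullet> c = (if b = c then 1 else 0)" if "b \<in> insert a C" "c \<in> insert a C" for b c
    using that Bo Be Ba ea aa ee eB aB ae by (auto simp: C_def)
  have expand: "v = (\<Sum>b\<in>insert a C. (v \<bullet> b) *\<^sub>R b)" for v
    by (rule orthonormal_family_expansion[of _ "\<lambda>b. b"]) (use C orth in auto)
  define \<Phi> where "\<Phi> = (\<lambda>I x. \<Sum>b\<in>I. x b *\<^sub>R (b :: real ^ 'm))"
  have \<Phi>m [measurable]: "\<Phi> I \<in> borel_measurable (?L I)" for I unfolding \<Phi>_def by measurable
  have \<Phi>_upd: "\<Phi> (insert b I) (x(b := s)) = s *\<^sub>R b + \<Phi> I x" if "finite I" "b \<notin> I" for b I x s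
  proof -
    have "(\<Sum>c\<in>I. (x(b := s)) c *\<^sub>R c) = (\<Sum>c\<in>I. x c *\<^sub>R c)" using that by (intro sum.cong) auto
    then show ?thesis using that by (simp add: \<Phi>_def)
  qed
  have \<Phi>C: "a \<bullet> \<Phi> C x = 0" for x
    using ea Ba by (auto simp: \<Phi>_def C_def inner_sum_right intro!: sum.neutral)
  have \<Phi>B: "a \<bullet> \<Phi> B x = 0" "(\<Sum>j\<in>UNIV. \<Phi> B x $ j) = 0" for x
  proof -
    show "a \<bullet> \<Phi> B x = 0" using Ba by (auto simp: \<Phi>_def inner_sum_right intro!: sum.neutral)
    have "e \<bullet> \<Phi> B x = 0" using Be by (auto simp: \<Phi>_def inner_sum_right intro!: sum.neutral)
    then show "(\<Sum>j\<in>UNIV. \<Phi> B x $ j) = 0" using M by (simp add: edot)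
  qed
  have p: "a \<bullet> p = 0" "(\<Sum>j\<in>UNIV. p $ j) = 1"
  proof -
    have "a \<bullet> center = 0" "(\<Sum>j\<in>UNIV. (center :: real ^ 'm) $ j) = 1"
      using ea esum M by (simp_all add: center sum_divide_distrib[symmetric])
    then show "a \<bullet> p = 0" "(\<Sum>j\<in>UNIV. p $ j) = 1"
      using T(2) by (auto simp: normal_tangent_space_iff inner_diff_right sum_subtractf)
  qed
  define V where "V = {x \<in> space (?L B). p + \<Phi> B x \<in> standard_simplex \<inter> {x. a \<bullet> x = 0}}"
  have V_iff: "x \<in> V \<longleftrightarrow> x \<in> space (?L B) \<and> (\<forall>j. 0 \<le> (p + \<Phi> B x) $ j)" for x
    using p \<Phi>B[of x] unfolding V_def mem_Collect_eq section_iff by (simp add: sum.distrib inner_add_right)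
  have Vm: "V \<in> sets (?L B)"
  proof -
    have "{z :: real ^ 'm. \<forall>j. 0 \<le> z $ j} \<in> sets borel"
      by (intro borel_closed closed_Collect_all closed_Collect_le continuous_intros)
    moreover have "(\<lambda>x. p + \<Phi> B x) \<in> borel_measurable (?L B)" by measurable
    ultimately have "(\<lambda>x. p + \<Phi> B x) -` {z. \<forall>j. 0 \<le> z $ j} \<inter> space (?L B) \<in> sets (?L B)"
      by (rule measurable_sets[rotated])
    also have "(\<lambda>x. p + \<Phi> B x) -` {z. \<forall>j. 0 \<le> z $ j} \<inter> space (?L B) = V"
      using V_iff by auto
    finally show ?thesis .
  qed
  define F where "F = (\<lambda>x. cone_weight (x - ((a \<bullet> x) / a $ k) *\<^sub>R axis k 1) * indicator {0..1} (a \<bullet> x))"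
  have Fm: "F \<in> borel_measurable borel" unfolding F_def by measurable
  \<comment> \<open>Moving by s along a and then projecting back along axis k amounts to a shift by
    s w inside the hyperplane, which translation invariance absorbs.\<close>
  define w where "w = a - (1 / a $ k) *\<^sub>R axis k 1"
  have wa: "w \<bullet> a = 0" using k aa by (simp add: w_def inner_diff_left inner_axis')
  have w: "w = (\<Sum>b\<in>C. (w \<bullet> b) *\<^sub>R b)"
    using expand[of w] C wa by simp
  have cwm: "(\<lambda>x. cone_weight (\<Phi> I x)) \<in> borel_measurable (?L I)" for I by measurable
  have "slab_integral k a = (\<integral>\<^sup>+x. F (\<Phi> (insert a C) x) \<partial>?L (insert a C))"
    unfolding slab_integral_def F_def[symmetric] \<Phi>_def
    by (rule nn_integral_orthonormal_family[symmetric, OF _ C(3) orth Fm]) (use C in auto)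
  also have "\<dots> = (\<integral>\<^sup>+s. (\<integral>\<^sup>+x. F (\<Phi> (insert a C) (x(a := s))) \<partial>?L C) \<partial>lborel)"
    by (rule lborelP.product_nn_integral_insert_rev[OF C(1,2)])
       (rule measurable_compose[OF \<Phi>m Fm])
  also have "\<dots> = (\<integral>\<^sup>+s. indicator {0..1 :: real} s * (\<integral>\<^sup>+x. cone_weight (\<Phi> C x) \<partial>?L C) \<partial>lborel)"
  proof (rule nn_integral_cong)
    fix s :: real
    have F: "F (\<Phi> (insert a C) (x(a := s))) = indicator {0..1} s * cone_weight (\<Phi> C (\<lambda>b\<in>C. s * (w \<bullet> b) + 1 * x b))" for x
    proof -
      have dot: "a \<bullet> (s *\<^sub>R a + \<Phi> C x) = s" using aa \<Phi>C by (simp add: inner_add_right)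
      have "s *\<^sub>R a + \<Phi> C x - (s / a $ k) *\<^sub>R axis k 1 = \<Phi> C x + s *\<^sub>R w"
        by (simp add: w_def scaleR_diff_right)
      also have "\<dots> = \<Phi> C (\<lambda>b\<in>C. s * (w \<bullet> b) + 1 * x b)"
        by (subst w) (simp add: \<Phi>_def scaleR_left_distrib sum.distrib scaleR_sum_right add.commute)
      finally show ?thesis unfolding F_def \<Phi>_upd[OF C(1,2)] dot by (simp add: mult.commute)
    qed
    have "(\<integral>\<^sup>+x. cone_weight (\<Phi> C (\<lambda>b\<in>C. s * (w \<bullet> b) + 1 * x b)) \<partial>?L C) = (\<integral>\<^sup>+x. cone_weight (\<Phi> C x) \<partial>?L C)"
      using nn_integral_PiM_lborel_affine[OF C(1), of 1 "\<lambda>x. cone_weight (\<Phi> C x)" "\<lambda>b. s * (w \<bullet> b)"] cwm by simp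
    moreover have "(\<lambda>x. cone_weight (\<Phi> C (\<lambda>b\<in>C. s * (w \<bullet> b) + 1 * x b))) \<in> borel_measurable (?L C)"
      by (rule measurable_compose[OF _ cwm]) measurable
    ultimately show "(\<integral>\<^sup>+x. F (\<Phi> (insert a C) (x(a := s))) \<partial>?L C) =
        indicator {0..1} s * (\<integral>\<^sup>+x. cone_weight (\<Phi> C x) \<partial>?L C)"
      unfolding F by (simp add: nn_integral_cmult)
  qed
  also have "\<dots> = (\<integral>\<^sup>+x. cone_weight (\<Phi> C x) \<partial>?L C)"
    by (subst nn_integral_multc) auto
  also have "\<dots> = (\<integral>\<^sup>+t. (\<integral>\<^sup>+x. cone_weight (\<Phi> C (x(e := t))) \<partial>?L B) \<partial>lborel)"
    unfolding C_def by (rule lborelP.product_nn_integral_insert_rev[OF B(1) eB cwm])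
  also have "\<dots> = (\<integral>\<^sup>+t. ennreal ((sqrt M * t) ^ d * exp (- (sqrt M * t))) * indicator {0..} (sqrt M * t) * emeasure (?L B) V \<partial>lborel)"
  proof (rule nn_integral_cong_AE)
    \<comment> \<open>The slice t = 0 is not a positive multiple of the section; for t < 0 the slice
      misses the orthant.\<close>
    have "AE t in lborel. t \<noteq> (0 :: real)" by (rule AE_lborel_singleton)
    then show "AE t in lborel. (\<integral>\<^sup>+x. cone_weight (\<Phi> C (x(e := t))) \<partial>?L B) =
        ennreal ((sqrt M * t) ^ d * exp (- (sqrt M * t))) * indicator {0..} (sqrt M * t) * emeasure (?L B) V"
    proof eventually_elim
      case (elim t)
      define r where "r = sqrt M * t"
      have \<Phi>C': "\<Phi> C (x(e := t)) = t *\<^sub>R e + \<Phi> B x" for x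
        unfolding C_def by (rule \<Phi>_upd[OF B(1) eB])
      have sum: "(\<Sum>j\<in>UNIV. (t *\<^sub>R e + \<Phi> B x) $ j) = r" for x
        using \<Phi>B(2)[of x] esum by (simp add: sum.distrib sum_distrib_left[symmetric] r_def)
      show ?case
      proof (cases "0 < t")
        case False
        then have "r < 0" using elim M by (simp add: r_def mult_less_0_iff)
        have "cone_weight (\<Phi> C (x(e := t))) = 0" for x
        proof -
          have "\<not> (\<forall>j. 0 \<le> (t *\<^sub>R e + \<Phi> B x) $ j)"
          proof
            assume "\<forall>j. 0 \<le> (t *\<^sub>R e + \<Phi> B x) $ j"
            then have "0 \<le> (\<Sum>j\<in>UNIV. (t *\<^sub>R e + \<Phi> B x) $ j)" by (intro sum_nonneg) blast
            then show False using sum[of x] \<open>r < 0\<close> by simp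
          qed
          then show ?thesis unfolding cone_weight_def \<Phi>C' indicator_def mem_Collect_eq by (simp only: if_False of_bool_eq) simp
        qed
        then show ?thesis using \<open>r < 0\<close> by (simp add: r_def[symmetric])
      next
        case True
        then have r: "0 < r" using M by (simp add: r_def)
        \<comment> \<open>Corrects for the origin: the slice is based at r times the barycentre, the
          frame at p. The map x to u + r x identifies the section in the frame with the
          slice.\<close>
        define u where "u = (\<lambda>b. r * ((p - center) \<bullet> b))"
        have pc: "p - center = (\<Sum>b\<in>B. ((p - center) \<bullet> b) *\<^sub>R b)"
          using expand[of "p - center"] T(2) C B eB
          by (simp add: C_def normal_tangent_space_iff inner_commute[of "p - center"] edot)
        have te: "t *\<^sub>R e = r *\<^sub>R center"
          using M by (simp add: center r_def)
        have shift: "t *\<^sub>R e + \<Phi> B (\<lambda>b\<in>B. u b + r * x b) = r *\<^sub>R (p + \<Phi> B x)" for x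
        proof -
          have "\<Phi> B (\<lambda>b\<in>B. u b + r * x b) = r *\<^sub>R (\<Sum>b\<in>B. ((p - center) \<bullet> b) *\<^sub>R b) + r *\<^sub>R \<Phi> B x"
            by (simp add: \<Phi>_def u_def scaleR_left_distrib sum.distrib scaleR_sum_right)
          also have "\<dots> = r *\<^sub>R (p - center) + r *\<^sub>R \<Phi> B x" unfolding pc[symmetric] ..
          finally show ?thesis unfolding te by (simp add: algebra_simps)
        qed
        have cw: "cone_weight (r *\<^sub>R (p + \<Phi> B x)) = ennreal (exp (- r)) * indicator V x" if "x \<in> space (?L B)" for x
        proof -
          have "(\<Sum>j\<in>UNIV. (r *\<^sub>R (p + \<Phi> B x)) $ j) = r"
            using p(2) \<Phi>B(2)[of x] by (simp add: sum_distrib_left[symmetric] sum.distrib)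
          moreover have "(\<forall>j. 0 \<le> (r *\<^sub>R (p + \<Phi> B x)) $ j) \<longleftrightarrow> x \<in> V"
            using r that by (simp add: V_iff zero_le_mult_iff)
          ultimately show ?thesis unfolding cone_weight_def indicator_def mem_Collect_eq by (simp only: mult.commute)
        qed
        have "(\<lambda>x. cone_weight (t *\<^sub>R e + \<Phi> B x)) \<in> borel_measurable (?L B)" by measurable
        then have "(\<integral>\<^sup>+x. cone_weight (t *\<^sub>R e + \<Phi> B x) \<partial>?L B) =
            ennreal \<bar>r\<bar> ^ card B * (\<integral>\<^sup>+x. cone_weight (t *\<^sub>R e + \<Phi> B (\<lambda>b\<in>B. u b + r * x b)) \<partial>?L B)"
          using r by (intro nn_integral_PiM_lborel_affine B(1)) auto
        also have "(\<integral>\<^sup>+x. cone_weight (t *\<^sub>R e + \<Phi> B (\<lambda>b\<in>B. u b + r * x b)) \<partial>?L B) =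
            (\<integral>\<^sup>+x. ennreal (exp (- r)) * indicator V x \<partial>?L B)"
          unfolding shift by (rule nn_integral_cong) (rule cw)
        also have "\<dots> = ennreal (exp (- r)) * emeasure (?L B) V"
          using Vm by (rule nn_integral_cmult_indicator)
        finally show ?thesis
          using r B(2) unfolding \<Phi>C' r_def[symmetric]
          by (simp add: ennreal_mult ennreal_power mult.assoc)
      qed
    qed
  qed
  also have "\<dots> = (\<integral>\<^sup>+t. ennreal ((sqrt M * t) ^ d * exp (- (sqrt M * t))) * indicator {0..} (sqrt M * t) \<partial>lborel) * emeasure (?L B) V"
    by (rule nn_integral_multc) measurable
  also have "(\<integral>\<^sup>+t. ennreal ((sqrt M * t) ^ d * exp (- (sqrt M * t))) * indicator {0..} (sqrt M * t) \<partial>lborel) = ennreal (fact d / sqrt M)"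
  proof -
    let ?I = "\<integral>\<^sup>+t. ennreal ((sqrt M * t) ^ d * exp (- (sqrt M * t))) * indicator {0..} (sqrt M * t) \<partial>lborel"
    \<comment> \<open>The Gamma integral for d!, rewritten by the substitution x = sqrt M *
      t.\<close>
    have "ennreal (fact d) = ennreal (sqrt M) * ?I"
      using nn_integral_real_affine[of "\<lambda>x. ennreal (x ^ d * exp (- x)) * indicator {0..} x" "sqrt M" 0] M
      by (simp add: nn_intergal_power_times_exp_Ici)
    then have "ennreal (1 / sqrt M) * ennreal (fact d) = ennreal (1 / sqrt M) * ennreal (sqrt M) * ?I"
      by (simp add: mult.assoc)
    also have "ennreal (1 / sqrt M) * ennreal (sqrt M) = 1"
      using M by (subst ennreal_mult'[symmetric]) auto
    finally show ?thesis using M by (simp add: ennreal_mult'[symmetric])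
  qed
  finally show ?thesis unfolding V_def \<Phi>_def d_def M_def .
qed

text \<open>Both evaluations of the slab integral are equated for the frame selected by the choice
  operator. With CARD('m) = n + 1 the constant is the known sqrt(n + 1) / (n - 1)!.\<close>

lemma section_volume_eq:
  fixes a :: "real ^ 'm"
  assumes a: "a \<in> normal_manifold" and k: "0 < a $ k" and l: "a $ l < 0"
  shows "section_volume a = sqrt (CARD('m)) / fact (CARD('m) - 2) * central_density k l (\<lambda>j. a $ j)"
proof -
  let ?S = "standard_simplex \<inter> {x. a \<bullet> x = 0}"
  have "k \<noteq> l" using k l by auto
  then have "card {k, l} = 2" by simp
  moreover have "card {k, l} \<le> CARD('m)" by (rule card_mono) auto
  ultimately have m: "2 \<le> CARD('m)" by simp
  obtain p B where pB: "(SOME (p, B). orthonormal_frame (CARD('m) - 2) ?S p B) = (p, B)"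
    by (rule prod.exhaust)
  obtain p' B' where "orthonormal_frame (CARD('m) - 2) ?S p' B'"
    using ex_orthonormal_frame_section[OF a] by blast
  then have "(\<lambda>(p, B). orthonormal_frame (CARD('m) - 2) ?S p B) (p', B')" by simp
  from someI[of "\<lambda>(p, B). orthonormal_frame (CARD('m) - 2) ?S p B", OF this] have fr: "orthonormal_frame (CARD('m) - 2) ?S p B" unfolding pB by simp
  define X where "X = {x \<in> space (\<Pi>\<^sub>M b\<in>B. (lborel :: real measure)). p + (\<Sum>b\<in>B. x b *\<^sub>R b) \<in> ?S}"
  define \<kappa> :: real where "\<kappa> = fact (CARD('m) - 2) / sqrt (CARD('m))"
  have \<kappa>: "0 < \<kappa>" by (simp add: \<kappa>_def)
  have s: "0 < central_density k l (\<lambda>j. a $ j)" by (rule central_density_pos[of _ k l]) (use k l in auto)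
  have "section_volume a = measure (\<Pi>\<^sub>M b\<in>B. (lborel :: real measure)) X"
    unfolding section_volume_def flat_volume_def pB X_def by simp
  have eq: "ennreal (central_density k l (\<lambda>j. a $ j)) = ennreal \<kappa> * emeasure (\<Pi>\<^sub>M b\<in>B. (lborel :: real measure)) X"
    using slab_integral_section[OF a k m fr] slab_integral_density[of a k l, OF k l] by (simp only: X_def \<kappa>_def)
  have "central_density k l (\<lambda>j. a $ j) = enn2real (ennreal (central_density k l (\<lambda>j. a $ j)))"
    using s by simp
  also have "\<dots> = \<kappa> * measure (\<Pi>\<^sub>M b\<in>B. (lborel :: real measure)) X"
    unfolding eq measure_def using \<kappa> by (simp add: enn2real_mult)
  finally have "central_density k l (\<lambda>j. a $ j) = \<kappa> * section_volume a"
    using \<open>section_volume a = _\<close> by simp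
  then show ?thesis by (simp add: \<kappa>_def)
qed

section \<open>Critical sections\<close>

text \<open>The section depends only on the direction of its normal vector while the density scales with
  degree -1, so derivatives along the sphere are derivatives along straight lines.\<close>
lemma critical_central_density:
  fixes a :: "real ^ 'm" and h :: "'m \<Rightarrow> real"
  assumes crit: "critical_normal a" and k: "0 < a $ k" and l: "a $ l < 0"
    and h: "(\<Sum>j\<in>UNIV. h j) = 0" "(\<Sum>j\<in>UNIV. a $ j * h j) = 0"
  shows "((\<lambda>t. central_density k l (\<lambda>j. a $ j + t * h j)) has_real_derivative 0) (at 0)"
proof -
  have a: "a \<in> normal_manifold" using crit by (simp add: critical_normal_def)
  obtain D where D: "(section_volume has_derivative D) (at a within normal_manifold)"
    and D0: "\<And>h. h \<in> normal_tangent_space a \<Longrightarrow> D h = 0"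
    using crit by (auto simp: critical_normal_def)
  define H :: "real ^ 'm" where "H = (\<chi> j. h j)"
  have H: "H \<in> normal_tangent_space a" "a \<bullet> H = 0" "(\<Sum>j\<in>UNIV. H $ j) = 0"
    using h by (simp_all add: normal_tangent_space_def H_def inner_vec_def)
  have asum: "(\<Sum>j\<in>UNIV. a $ j) = 0" and aa: "a \<bullet> a = 1"
    using a by (auto simp: normal_manifold_def inner_vec_def power2_eq_square)
  \<comment> \<open>The norm of a + t H, as a is a unit vector orthogonal to H. It is stationary at
    0, so normalisation does not affect the first derivative.\<close>
  define \<rho> where "\<rho> = (\<lambda>t. sqrt (1 + t\<^sup>2 * (H \<bullet> H)))"
  have \<rho>1: "0 < \<rho> t" "\<rho> 0 = 1" "(\<rho> t)\<^sup>2 = 1 + t\<^sup>2 * (H \<bullet> H)" for t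
    by (simp_all add: \<rho>_def add_pos_nonneg)
  have \<rho>': "(\<rho> has_real_derivative 0) (at 0)"
    unfolding \<rho>_def by (auto intro!: derivative_eq_intros)
  have \<rho>i: "((\<lambda>t. 1 / \<rho> t) has_real_derivative 0) (at 0)"
    using \<rho>' \<rho>1(2) by (auto intro!: derivative_eq_intros)
  define \<gamma> where "\<gamma> = (\<lambda>t. (1 / \<rho> t) *\<^sub>R (a + t *\<^sub>R H))"
  have \<gamma>0: "\<gamma> 0 = a" by (simp add: \<gamma>_def \<rho>1)
  have \<gamma>m: "\<gamma> t \<in> normal_manifold" for t
  proof -
    have "(\<Sum>j\<in>UNIV. \<gamma> t $ j) = 0"
      using asum H(3) by (simp add: \<gamma>_def sum_divide_distrib[symmetric] sum.distrib sum_distrib_left[symmetric])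
    moreover have "\<gamma> t \<bullet> \<gamma> t = 1"
    proof -
      have "(a + t *\<^sub>R H) \<bullet> (a + t *\<^sub>R H) = (\<rho> t)\<^sup>2"
        unfolding \<rho>1(3) using aa H(2)
        by (simp add: inner_add_left inner_add_right inner_commute power2_eq_square)
      then show ?thesis using \<rho>1(1)[of t] by (simp add: \<gamma>_def power2_eq_square)
    qed
    ultimately show ?thesis by (simp add: normal_manifold_def inner_vec_def power2_eq_square)
  qed
  have "(\<gamma> has_vector_derivative (1 / \<rho> 0) *\<^sub>R H + 0 *\<^sub>R (a + 0 *\<^sub>R H)) (at 0)"
    unfolding \<gamma>_def
    by (rule has_vector_derivative_scaleR[OF \<rho>i]) (auto intro!: derivative_eq_intros)
  then have \<gamma>': "(\<gamma> has_derivative (\<lambda>t. t *\<^sub>R H)) (at 0)"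
    by (simp add: has_vector_derivative_def \<rho>1)
  \<comment> \<open>The derivative is given only within the manifold; restricting it to the image of
    the curve makes the chain rule applicable.\<close>
  have "(section_volume has_derivative D) (at (\<gamma> 0) within range \<gamma>)"
    unfolding \<gamma>0 by (rule has_derivative_subset[OF D]) (use \<gamma>m in auto)
  from has_derivative_in_compose[OF \<gamma>' this]
  have "((\<lambda>t. section_volume (\<gamma> t)) has_derivative (\<lambda>t. D (t *\<^sub>R H))) (at 0)" .
  moreover have "D (t *\<^sub>R H) = 0" for t
    using has_derivative_linear[OF D] D0[OF H(1)] by (simp add: linear_scale)
  ultimately have V': "((\<lambda>t. section_volume (\<gamma> t)) has_real_derivative 0) (at 0)"
    by (simp add: has_field_derivative_def mult_zero_left[abs_def])
  define c :: real where "c = sqrt (CARD('m)) / fact (CARD('m) - 2)"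
  have c: "c \<noteq> 0" by (simp add: c_def)
  \<comment> \<open>Only near t = 0 do coordinates k and l keep their signs, on which the volume
    formula depends.\<close>
  have ev: "\<forall>\<^sub>F t in nhds 0. central_density k l (\<lambda>j. a $ j + t * h j) = section_volume (\<gamma> t) / c * (1 / \<rho> t)"
  proof -
    have "open {t. 0 < a $ k + t * h k \<and> a $ l + t * h l < 0}"
      by (intro open_Collect_conj open_Collect_less continuous_intros)
    then have "\<forall>\<^sub>F t in nhds 0. t \<in> {t. 0 < a $ k + t * h k \<and> a $ l + t * h l < 0}"
      using k l by (intro eventually_nhds_in_open) auto
    then show ?thesis
    proof eventually_elim
      case (elim t)
      have \<gamma>t: "\<gamma> t $ j = (1 / \<rho> t) * (a $ j + t * h j)" for j
        by (simp add: \<gamma>_def H_def)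
      have "0 < \<gamma> t $ k" "\<gamma> t $ l < 0"
        using elim \<rho>1(1)[of t] by (auto simp: \<gamma>t divide_neg_pos)
      then have "section_volume (\<gamma> t) = c * central_density k l (\<lambda>j. \<gamma> t $ j)"
        unfolding c_def by (rule section_volume_eq[OF \<gamma>m])
      also have "\<dots> = c * (central_density k l (\<lambda>j. a $ j + t * h j) / (1 / \<rho> t))"
        unfolding \<gamma>t using \<rho>1(1)[of t] by (subst central_density_scale) auto
      finally show ?case using c \<rho>1(1)[of t] by simp
    qed
  qed
  show ?thesis
    unfolding DERIV_cong_ev[OF refl ev refl]
    using V' \<rho>' c \<rho>1(2) by (auto intro!: derivative_eq_intros)
qed

theorem theorem2:
  fixes n :: nat and a :: "real ^ 'm"
  assumes "n \<ge> 1"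
    and "CARD('m) = n + 1"
    and "(\<Sum>j\<in>UNIV. a $ j) = 0"
    and "(\<Sum>j\<in>UNIV. (a $ j)\<^sup>2) = 1"
    and "critical_normal a"
  shows "card {a $ j | j. a $ j \<noteq> 0} \<le> 3"
proof -
  have "\<exists>i. a $ i \<noteq> 0"
  proof (rule ccontr)
    assume "\<nexists>i. a $ i \<noteq> 0"
    then show False using assms(4) by simp
  qed
  have "\<exists>k. 0 < a $ k"
  proof (rule ccontr)
    assume "\<nexists>k. 0 < a $ k"
    then have "\<forall>j\<in>UNIV. - a $ j = 0"
      using assms(3) by (subst sum_nonneg_eq_0_iff[symmetric]) (auto simp: not_less sum_negf)
    then show False using \<open>\<exists>i. a $ i \<noteq> 0\<close> by auto
  qed
  then obtain k where k: "0 < a $ k" by blast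
  have "\<exists>l. a $ l < 0"
  proof (rule ccontr)
    assume "\<nexists>l. a $ l < 0"
    then have "\<forall>j\<in>UNIV. a $ j = 0"
      using assms(3) by (subst sum_nonneg_eq_0_iff[symmetric]) (auto simp: not_less)
    then show False using \<open>\<exists>i. a $ i \<noteq> 0\<close> by auto
  qed
  then obtain l where l: "a $ l < 0" by blast
  have "card (range (\<lambda>j. a $ j) - {0}) \<le> 3"
    using k l assms(3,4) critical_central_density[OF assms(5) k l]
    by (intro critical_density_at_most_three[of "\<lambda>j. a $ j" k l]) auto
  also have "range (\<lambda>j. a $ j) - {0} = {a $ j | j. a $ j \<noteq> 0}" by auto
  finally show ?thesis .
qed

end
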